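(* Let $(\chi,h)$ be a recursive tree system such that $\chi$ has finite expectation and more than one point of support, let $\Psi$ be the automaton distribution map of $(\chi,h)$, and let $0<x_0<1$ be a fixed point of $(\chi,h)$, i.e. $\Psi(x_0)=x_0$. There exists an interpretation $\mathcal{T}$ of $(\chi,h)$ with $\mathrm{GW}_\chi(\mathcal{T})=x_0$ if and only if $\Psi'(x_0)\leq 1$. When such an interpretation associated with $x_0$ exists, it is unique up to $\mathrm{GW}_\chi$-negligible sets.
   Context: A child distribution $\chi$ is a probability measure on $\mathbb{N}=\{0,1,2,\ldots\}$; write $\chi(n)=\chi(\{n\})$. A recursive tree system $(\chi,h)$ consists of a child distribution $\chi$ and a threshold function $h\colon\mathbb{N}\to\{1,2,3,\ldots\}$ (so $h(\ell)\geq 1$ for all $\ell\geq 0$). Its automaton distribution map is $\Psi\colon[0,1]\to[0,1]$, $\Psi(x)=\sum_{\ell=0}^\infty \chi(\ell)\,\mathbb{P}[\mathrm{Bin}(\ell,x)\geq h(\ell)]$, where $\mathrm{Bin}(\ell,x)$ is a binomial random variable. A fixed point of $(\chi,h)$ is a fixed point of $\Psi$. $\mathrm{GW}_\chi$ is the Galton--Watson measure with child distribution $\chi$ on the space of rooted trees. For a rooted tree $t$, $\ell(t)$ is the number of children of the root, and the root-child subtrees of $t$ are the subtrees originated by the children of the root. For a set of trees $\mathcal{T}$, $c(t,\mathcal{T})$ is the number of root-child subtrees of $t$ that are elements of $\mathcal{T}$. A $\mathrm{GW}_\chi$-measurable set of trees $\mathcal{T}$ is an interpretation of $(\chi,h)$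 if, for $\mathrm{GW}_\chi$-a.e. rooted tree $t$, $t\in\mathcal{T}\iff c(t,\mathcal{T})\geq h(\ell(t))$. If $\mathrm{GW}_\chi(\mathcal{T})=x_0$, the interpretation $\mathcal{T}$ is said to be associated with the fixed point $x_0$. *)

theory Defs
  imports "HOL-Probability.Probability"
begin

text \<open>
  Rooted trees are locally finite and given in Ulam--Harris coding: a vertex is the list of child
  indices leading to it from the root \<open>[]\<close>, and the children of \<open>v\<close> are
  \<open>v @ [0], \<dots>, v @ [n - 1]\<close>.
\<close>

definition rooted_trees :: "nat list set set" where
  "rooted_trees = {t. [] \<in> t \<and> (\<forall>v i. v @ [i] \<in> t \<longrightarrow> v \<in> t) \<and>
                      (\<forall>v\<in>t. \<exists>n. {i. v @ [i] \<in> t} = {..<n})}"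

definition num_children :: "nat list set \<Rightarrow> nat" where
  "num_children t = card {i. [i] \<in> t}"

definition child_subtree :: "nat list set \<Rightarrow> nat \<Rightarrow> nat list set" where
  "child_subtree t i = {v. i # v \<in> t}"

text \<open>Root-child subtrees are counted with multiplicity, i.e.\ one for each child of the root.\<close>

definition child_count :: "nat list set \<Rightarrow> nat list set set \<Rightarrow> nat" where
  "child_count t \<T> = card {i. [i] \<in> t \<and> child_subtree t i \<in> \<T>}"

definition tree_space :: "nat list set measure" where
  "tree_space = sigma rooted_trees (range (\<lambda>v. {t \<in> rooted_trees. v \<in> t}))"

text \<open>
  \<open>tree_of N\<close> is the tree in which every vertex \<open>v\<close> has \<open>N v\<close> children. The Galton--Watson
  measure is its law when the numbers \<open>N v\<close> are independent with law \<open>chi\<close>.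
\<close>

definition tree_of :: "(nat list \<Rightarrow> nat) \<Rightarrow> nat list set" where
  "tree_of N = {v. \<forall>k<length v. v ! k < N (take k v)}"

definition GW :: "nat pmf \<Rightarrow> nat list set measure" where
  "GW chi = distr (PiM UNIV (\<lambda>_. measure_pmf chi)) tree_space tree_of"

lemma tree_of_in_rooted_trees: "tree_of N \<in> rooted_trees"
proof -
  have snoc: "v @ [i] \<in> tree_of N \<longleftrightarrow> v \<in> tree_of N \<and> i < N v" for v i
    by (auto simp: tree_of_def nth_append less_Suc_eq)
  have "[] \<in> tree_of N"
    by (simp add: tree_of_def)
  then show ?thesis
    by (auto simp: rooted_trees_def snoc intro!: exI[of _ "N _"])
qed

lemma measurable_tree_of:
  "tree_of \<in> (PiM UNIV (\<lambda>_. measure_pmf chi)) \<rightarrow>\<^sub>M tree_space"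
  unfolding tree_space_def
proof (rule measurable_measure_of)
  fix A assume "A \<in> range (\<lambda>v. {t \<in> rooted_trees. v \<in> t})"
  then obtain v where A: "A = {t \<in> rooted_trees. v \<in> t}"
    by auto
  have "{N \<in> space (PiM UNIV (\<lambda>_. measure_pmf chi)). \<forall>k\<in>{..<length v}. v ! k < N (take k v)}
          \<in> sets (PiM UNIV (\<lambda>_. measure_pmf chi))"
    by measurable
  also have "{N \<in> space (PiM UNIV (\<lambda>_. measure_pmf chi)). \<forall>k\<in>{..<length v}. v ! k < N (take k v)}
          = tree_of -` A \<inter> space (PiM UNIV (\<lambda>_. measure_pmf chi))"
    using tree_of_in_rooted_trees by (auto simp: A tree_of_def)
  finally show "tree_of -` A \<inter> space (PiM UNIV (\<lambda>_. measure_pmf chi))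
                  \<in> sets (PiM UNIV (\<lambda>_. measure_pmf chi))" .
qed (use tree_of_in_rooted_trees in auto)

definition automaton_map :: "nat pmf \<Rightarrow> (nat \<Rightarrow> nat) \<Rightarrow> real \<Rightarrow> real" where
  "automaton_map chi h x = (\<Sum>l. pmf chi l * measure_pmf.prob (binomial_pmf l x) {h l..})"

text \<open>
  \<open>GW chi\<close>-measurable sets of trees are those in the completed \<open>\<sigma>\<close>-algebra.
\<close>

definition is_interpretation :: "nat pmf \<Rightarrow> (nat \<Rightarrow> nat) \<Rightarrow> nat list set set \<Rightarrow> bool" where
  "is_interpretation chi h \<T> \<longleftrightarrow>
     \<T> \<in> sets (completion (GW chi)) \<and>
     (AE t in GW chi. t \<in> \<T> \<longleftrightarrow> child_count t \<T> \<ge> h (num_children t))"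

end

theory Submission
  imports Defs
begin

text \<open>
  Write \<open>X\<close> for the indicator of an interpretation \<open>\<T>\<close> with probability \<open>x0\<close>. Given the first \<open>n\<close>
  generations of the tree, the values of \<open>X\<close> at the subtrees rooted in generation \<open>n\<close> are independent
  Bernoulli variables with parameter \<open>x0\<close>, so the conditional expectation of \<open>X\<close> is computed by
  starting from the constant \<open>x0\<close> at generation \<open>n\<close> and propagating it to the root through the
  multilinear extensions of the threshold rules. This is the function \<open>posterior n\<close>; it
  depends on the rules only. Since \<open>X\<close> is measurable, these conditional expectations converge to it.
  Therefore \<open>X\<close> is unique, and it exists precisely if the functions \<open>posterior n\<close> converge to a
  function with values in \<open>{0, 1}\<close>, that is, if their variances increase to the variance
  \<open>x0 * (1 - x0)\<close> of a label.

  These variances obey a recursion in one real variable. A Boolean function of \<open>l\<close> independent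
  labels with mean \<open>x0\<close> is a sum of products of centred labels over the subsets of \<open>{..<l}\<close>, and
  independence makes distinct products orthogonal. Hence if two labellings of the children have mean
  \<open>x0\<close> and covariance \<open>c\<close>, then the two labels which they induce at the root have covariance
  \<open>cov_map c\<close>, where \<open>cov_map\<close> is a power series whose coefficients are averages of squares, except that
  \<open>x0\<^sup>2\<close> is subtracted from the constant one (\<open>integral_step_mult\<close>). All of them are nonnegative. The
  variance of \<open>posterior n\<close> is the \<open>n\<close>-th iterate of \<open>cov_map\<close> at 0.

  Up to rescaling, \<open>cov_map\<close> is the generating function of a probability distribution: it fixes
  \<open>x0 * (1 - x0)\<close> by Parseval's identity. Its slope there is the expected number of children whose
  label is pivotal for the root (\<open>influence_parseval\<close>), and by the Margulis--Russo formula this is also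
  the derivative of \<open>\<Psi>\<close> at \<open>x0\<close> (\<open>deriv_automaton_map\<close>). As for the extinction probability of a branching
  process, the iterates reach \<open>x0 * (1 - x0)\<close> if and only if the slope is at most 1 (\<open>cov_tendsto\<close>,
  \<open>expected_influence_le_1\<close>). At slope 1 this requires that \<open>cov_map\<close> is not the identity, which holds
  because a threshold rule with at least two inputs is affine only if it cannot be satisfied
  (\<open>threshold_nonlinear\<close>) and because the number of children is not almost surely 1.

  The convergence of the conditional expectations is proved without martingales: resampling all offspring
  numbers from generation \<open>n\<close> on changes \<open>X\<close> with probability exactly twice the missing variance
  (\<open>solution_unstable\<close>), and for every event the probability of such a change tends to 0
  (\<open>unstable_tendsto_0\<close>). Conversely, if the variances increase to \<open>x0 * (1 - x0)\<close>, then the sequence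
  \<open>posterior\<close> is Cauchy in \<open>L\<^sup>2\<close>, and an almost sure limit along a subsequence is the required
  indicator (\<open>solution_exists\<close>).
\<close>

section \<open>Multilinear functions of independent Bernoulli variables\<close>

text \<open>
  The expectation of \<open>f\<close> at a random subset of \<open>{..<l}\<close> which contains each \<open>i\<close> independently with
  probability \<open>z i\<close>.
\<close>

definition multilinear :: "nat \<Rightarrow> (nat set \<Rightarrow> real) \<Rightarrow> (nat \<Rightarrow> real) \<Rightarrow> real" where
  "multilinear l f z = (\<Sum>A\<in>Pow {..<l}. f A * (\<Prod>i<l. if i \<in> A then z i else 1 - z i))"

text \<open>
  The coefficient of \<open>\<Prod>i\<in>S. (z i - x)\<close> when \<open>multilinear l f z\<close> is expanded around the point \<open>x\<close>
  (\<open>multilinear_expand\<close>), that is, the Fourier coefficient of \<open>f\<close> for the biased product measure with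
  parameter \<open>x\<close>, for a basis which is orthogonal but not normalised.
\<close>

definition fourier_coeff :: "nat \<Rightarrow> (nat set \<Rightarrow> real) \<Rightarrow> real \<Rightarrow> nat set \<Rightarrow> real" where
  "fourier_coeff l f x S = (\<Sum>A\<in>Pow {..<l}. f A *
     (\<Prod>i<l. if i \<in> S then (if i \<in> A then 1 else - 1) else (if i \<in> A then x else 1 - x)))"

lemma prod_if_subset:
  fixes p q :: "nat \<Rightarrow> 'a::comm_monoid_mult"
  assumes "S \<subseteq> {..<l}"
  shows "(\<Prod>i<l. if i \<in> S then p i else q i) = (\<Prod>i\<in>S. p i) * (\<Prod>i\<in>{..<l} - S. q i)"
proof -
  have "{..<l} \<inter> S = S" "{..<l} \<inter> - S = {..<l} - S"
    using assms by auto
  then show ?thesis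
    by (simp add: prod.If_cases)
qed

lemma prod_add_subsets:
  fixes p q :: "nat \<Rightarrow> real"
  shows "(\<Prod>i<l. p i + q i) = (\<Sum>S\<in>Pow {..<l}. \<Prod>i<l. if i \<in> S then p i else q i)"
  by (subst prod_add) (auto intro!: sum.cong simp: prod_if_subset)

lemma multilinear_expand:
  "multilinear l f z = (\<Sum>S\<in>Pow {..<l}. fourier_coeff l f x S * (\<Prod>i\<in>S. z i - x))"
proof -
  let ?u = "\<lambda>A i. if i \<in> A then 1 else - 1 :: real"
  let ?w = "\<lambda>A i. if i \<in> A then x else 1 - x"
  have *: "(\<Prod>i<l. if i \<in> A then z i else 1 - z i) =
     (\<Sum>S\<in>Pow {..<l}. (\<Prod>i<l. if i \<in> S then ?u A i else ?w A i) * (\<Prod>i\<in>S. z i - x))" for A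
  proof -
    have "(\<Prod>i<l. if i \<in> A then z i else 1 - z i) = (\<Prod>i<l. ?u A i * (z i - x) + ?w A i)"
      by (intro prod.cong) auto
    also have "\<dots> = (\<Sum>S\<in>Pow {..<l}. \<Prod>i<l. if i \<in> S then ?u A i * (z i - x) else ?w A i)"
      by (rule prod_add_subsets)
    also have "\<dots> = (\<Sum>S\<in>Pow {..<l}. (\<Prod>i<l. if i \<in> S then ?u A i else ?w A i) * (\<Prod>i\<in>S. z i - x))"
      by (intro sum.cong refl) (auto simp: prod_if_subset prod.distrib mult_ac)
    finally show ?thesis .
  qed
  have "multilinear l f z = (\<Sum>A\<in>Pow {..<l}. \<Sum>S\<in>Pow {..<l}. f A *
      ((\<Prod>i<l. if i \<in> S then ?u A i else ?w A i) * (\<Prod>i\<in>S. z i - x)))"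
    unfolding multilinear_def * sum_distrib_left ..
  also have "\<dots> = (\<Sum>S\<in>Pow {..<l}. \<Sum>A\<in>Pow {..<l}. f A *
      ((\<Prod>i<l. if i \<in> S then ?u A i else ?w A i) * (\<Prod>i\<in>S. z i - x)))"
    by (rule sum.swap)
  also have "\<dots> = (\<Sum>S\<in>Pow {..<l}. fourier_coeff l f x S * (\<Prod>i\<in>S. z i - x))"
    unfolding fourier_coeff_def sum_distrib_right by (simp add: mult_ac)
  finally show ?thesis .
qed

lemma multilinear_sum: "multilinear l (\<lambda>A. \<Sum>j\<in>J. c j * g j A) z = (\<Sum>j\<in>J. c j * multilinear l (g j) z)"
proof -
  have "multilinear l (\<lambda>A. \<Sum>j\<in>J. c j * g j A) z =
      (\<Sum>A\<in>Pow {..<l}. \<Sum>j\<in>J. c j * (g j A * (\<Prod>i<l. if i \<in> A then z i else 1 - z i)))"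
    by (simp add: multilinear_def sum_distrib_right mult_ac)
  also have "\<dots> = (\<Sum>j\<in>J. \<Sum>A\<in>Pow {..<l}. c j * (g j A * (\<Prod>i<l. if i \<in> A then z i else 1 - z i)))"
    by (rule sum.swap)
  finally show ?thesis by (simp add: multilinear_def sum_distrib_left)
qed

lemma multilinear_cong: "(\<And>A. A \<subseteq> {..<l} \<Longrightarrow> f A = g A) \<Longrightarrow> (\<And>i. i < l \<Longrightarrow> z i = w i) \<Longrightarrow> multilinear l f z =
    multilinear l g w"
  unfolding multilinear_def by (intro sum.cong arg_cong2[where f="(*)"] prod.cong) auto

text \<open>
  Independence: the expectation of a product over the coordinates factorises.
\<close>

lemma multilinear_prod:
  "multilinear l (\<lambda>A. \<Prod>i<l. if i \<in> A then p i else q i) z = (\<Prod>i<l. z i * p i + (1 - z i) * q i)"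
proof -
  have "multilinear l (\<lambda>A. \<Prod>i<l. if i \<in> A then p i else q i) z =
    (\<Sum>A\<in>Pow {..<l}. \<Prod>i<l. if i \<in> A then z i * p i else (1 - z i) * q i)"
    unfolding multilinear_def prod.distrib[symmetric] by (intro sum.cong prod.cong refl) auto
  then show ?thesis by (simp only: prod_add_subsets)
qed

lemma multilinear_bool:
  assumes "A \<subseteq> {..<l}"
  shows "multilinear l f (\<lambda>i. of_bool (i \<in> A)) = f A"
proof -
  have "f B * (\<Prod>i<l. if i \<in> B then of_bool (i \<in> A) else 1 - of_bool (i \<in> A)) = (if B = A then f A else 0)"
    if "B \<subseteq> {..<l}" for B
  proof (cases "B = A")
    case True
    then show ?thesis by (auto intro!: prod.neutral)
  next
    case False
    with that assms obtain i where "i < l" "(i \<in> B) \<noteq> (i \<in> A)" by blast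
    then have "(\<Prod>i<l. if i \<in> B then of_bool (i \<in> A) else 1 - of_bool (i \<in> A)) = (0::real)"
      by (intro prod_zero bexI[of _ i]) auto
    then show ?thesis using False by simp
  qed
  then have "multilinear l f (\<lambda>i. of_bool (i \<in> A)) = (\<Sum>B\<in>Pow {..<l}. if B = A then f A else 0)"
    unfolding multilinear_def by (intro sum.cong) auto
  then show ?thesis using assms by simp
qed

lemma fourier_expand:
  assumes "A \<subseteq> {..<l}"
  shows "f A = (\<Sum>S\<in>Pow {..<l}. fourier_coeff l f x S * (\<Prod>i\<in>S. of_bool (i \<in> A) - x))"
  using multilinear_bool[OF assms, of f] multilinear_expand[of l f _ x] by simp

lemma multilinear_mono:
  assumes "\<And>A. A \<subseteq> {..<l} \<Longrightarrow> f A \<le> g A" "\<And>i. i < l \<Longrightarrow> 0 \<le> z i" "\<And>i. i < l \<Longrightarrow> z i \<le> 1"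
  shows "multilinear l f z \<le> multilinear l g z"
  unfolding multilinear_def using assms by (intro sum_mono mult_right_mono prod_nonneg) auto

lemma multilinear_const: "multilinear l (\<lambda>_. c) z = c"
proof -
  have "multilinear l (\<lambda>_. c) z = c * (\<Sum>A\<in>Pow {..<l}. \<Prod>i<l. if i \<in> A then z i else 1 - z i)"
    by (simp add: multilinear_def sum_distrib_left)
  also have "\<dots> = c" by (simp add: prod_add_subsets[symmetric])
  finally show ?thesis .
qed

text \<open>
  The left-hand side is the expectation of a product of centred variables over \<open>S\<close> times one over \<open>S'\<close>,
  where the two variables with the same index have covariance \<open>c\<close>: a single index that lies in only one of
  the two sets makes it vanish.
\<close>

lemma prod_orth:
  fixes l :: nat
  assumes "S \<subseteq> {..<l}" "S' \<subseteq> {..<l}"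
  shows "(\<Prod>i<l. if i \<in> S then (if i \<in> S' then c else 0) else (if i \<in> S' then 0 else 1)) =
    (if S = S' then c ^ card S else 0 :: real)"
proof (cases "S = S'")
  case True
  have "(\<Prod>i<l. if i \<in> S then (if i \<in> S' then c else 0) else (if i \<in> S' then 0 else 1)) =
    (\<Prod>i<l. if i \<in> S then c else 1)" using True by (intro prod.cong) auto
  also have "\<dots> = c ^ card S"
    using prod_if_subset[OF assms(1), of "\<lambda>_. c" "\<lambda>_. 1"] by simp
  finally show ?thesis using True by simp
next
  case False
  with assms obtain i where "i < l" "(i \<in> S) \<noteq> (i \<in> S')" by blast
  then show ?thesis using False
    by (subst prod_zero) (auto intro!: bexI[of _ i])
qed

lemma prod_pair:
  fixes p q :: "nat \<Rightarrow> real"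
  assumes "S \<subseteq> {..<l}" "S' \<subseteq> {..<l}"
  shows "(\<Prod>i\<in>S. p i) * (\<Prod>i\<in>S'. q i) =
    (\<Prod>i<l. (if i \<in> S then p i else 1) * (if i \<in> S' then q i else 1))"
  using assms by (simp add: prod.distrib prod_if_subset)

lemma multilinear_char:
  assumes "S \<subseteq> {..<l}" "S' \<subseteq> {..<l}"
  shows "multilinear l (\<lambda>A. (\<Prod>i\<in>S. of_bool (i \<in> A) - x) * (\<Prod>i\<in>S'. of_bool (i \<in> A) - x)) (\<lambda>_. x) =
    (if S = S' then (x * (1 - x)) ^ card S else 0)"
proof -
  have "multilinear l (\<lambda>A. (\<Prod>i\<in>S. of_bool (i \<in> A) - x) * (\<Prod>i\<in>S'. of_bool (i \<in> A) - x)) (\<lambda>_. x) =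
    multilinear l (\<lambda>A. \<Prod>i<l. if i \<in> A then (if i \<in> S then 1 - x else 1) * (if i \<in> S' then 1 - x else 1)
        else (if i \<in> S then - x else 1) * (if i \<in> S' then - x else 1)) (\<lambda>_. x)"
    unfolding prod_pair[OF assms] by (intro multilinear_cong prod.cong refl) auto
  also have "\<dots> = (\<Prod>i<l. if i \<in> S then (if i \<in> S' then x * (1 - x) else 0) else (if i \<in> S' then 0 else 1))"
    unfolding multilinear_prod by (intro prod.cong refl) (auto simp: algebra_simps)
  also have "\<dots> = (if S = S' then (x * (1 - x)) ^ card S else 0)"
    by (rule prod_orth[OF assms])
  finally show ?thesis .
qed

lemma sum_diagonal:
  assumes "finite P"
  shows "(\<Sum>S\<in>P. \<Sum>S'\<in>P. a S * b S' * (if S = S' then d S else 0)) = (\<Sum>S\<in>P. a S * b S * (d S :: real))"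
  using assms by (simp add: if_distrib[of "\<lambda>x. _ * x"] cong: if_cong)

lemma parseval:
  assumes "\<And>A. A \<subseteq> {..<l} \<Longrightarrow> f A = (\<Sum>S\<in>Pow {..<l}. b S * (\<Prod>i\<in>S. of_bool (i \<in> A) - x))"
  shows "multilinear l (\<lambda>A. (f A)\<^sup>2) (\<lambda>_. x) = (\<Sum>S\<in>Pow {..<l}. (b S)\<^sup>2 * (x * (1 - x)) ^ card S)"
    and "multilinear l f (\<lambda>_. x) = b {}"
proof -
  let ?c = "\<lambda>S A. \<Prod>i\<in>S. of_bool (i \<in> A) - x"
  have "multilinear l (\<lambda>A. (f A)\<^sup>2) (\<lambda>_. x) =
     multilinear l (\<lambda>A. \<Sum>p\<in>Pow {..<l} \<times> Pow {..<l}. (b (fst p) * b (snd p)) * (?c (fst p) A * ?c (snd p) A))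
         (\<lambda>_. x)"
    by (intro multilinear_cong refl)
       (simp add: assms power2_eq_square sum_product sum.cartesian_product case_prod_unfold mult_ac)
  also have "\<dots> = (\<Sum>p\<in>Pow {..<l} \<times> Pow {..<l}. (b (fst p) * b (snd p)) *
     (if fst p = snd p then (x * (1 - x)) ^ card (fst p) else 0))"
    unfolding multilinear_sum
    by (intro sum.cong refl arg_cong2[where f="(*)"]) (auto simp only: multilinear_char mem_Times_iff Pow_iff)
  also have "\<dots> = (\<Sum>S\<in>Pow {..<l}. b S * b S * (x * (1 - x)) ^ card S)"
    by (subst sum_diagonal[symmetric]) (simp_all add: sum.cartesian_product case_prod_unfold)
  finally show "multilinear l (\<lambda>A. (f A)\<^sup>2) (\<lambda>_. x) = (\<Sum>S\<in>Pow {..<l}. (b S)\<^sup>2 * (x * (1 - x)) ^ card S)"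
    by (simp add: power2_eq_square)
  have "multilinear l f (\<lambda>_. x) = multilinear l (\<lambda>A. \<Sum>S\<in>Pow {..<l}. b S * ?c S A) (\<lambda>_. x)"
    by (intro multilinear_cong assms refl)
  also have "\<dots> = (\<Sum>S\<in>Pow {..<l}. b S * (if S = {} then 1 else 0))"
    unfolding multilinear_sum
  proof (intro sum.cong refl arg_cong2[where f="(*)"])
    fix S assume "S \<in> Pow {..<l}"
    then show "multilinear l (?c S) (\<lambda>_. x) = (if S = {} then 1 else 0)"
      using multilinear_char[of S l "{}" x] by auto
  qed
  finally show "multilinear l f (\<lambda>_. x) = b {}" by (simp add: if_distrib[of "\<lambda>x. _ * x"] cong: if_cong)
qed

lemma multilinear_diagonal: "multilinear l f (\<lambda>_. x) = fourier_coeff l f x {}"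
  by (rule parseval(2)) (rule fourier_expand)

definition boolean_monotone :: "nat \<Rightarrow> (nat set \<Rightarrow> real) \<Rightarrow> bool" where
  "boolean_monotone l f \<longleftrightarrow> (\<forall>A\<subseteq>{..<l}. f A \<in> {0, 1}) \<and> (\<forall>A B. A \<subseteq> B \<longrightarrow> B \<subseteq> {..<l} \<longrightarrow> f A \<le> f B)"

text \<open>
  Flipping coordinate \<open>i\<close> cancels all products that do not contain \<open>i\<close> and removes the factor of \<open>i\<close> from
  the others.
\<close>

lemma discrete_derivative_expand:
  assumes i: "i < l" and A: "A \<subseteq> {..<l}"
  shows "f (insert i A) - f (A - {i}) =
    (\<Sum>S\<in>Pow {..<l}. (if i \<in> S then 0 else fourier_coeff l f x (insert i S)) * (\<Prod>j\<in>S. of_bool (j \<in> A) - x))"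
proof -
  let ?c = "\<lambda>S A. \<Prod>j\<in>S. of_bool (j \<in> A) - x"
  let ?T = "{S. S \<subseteq> {..<l} \<and> i \<in> S}" and ?T' = "{S. S \<subseteq> {..<l} \<and> i \<notin> S}"
  have fin: "finite S" if "S \<subseteq> {..<l}" for S using that finite_subset by blast
  have "f (insert i A) - f (A - {i}) =
      (\<Sum>S\<in>Pow {..<l}. fourier_coeff l f x S * (?c S (insert i A) - ?c S (A - {i})))"
    using i A by (simp add: fourier_expand[of "insert i A" l f x] fourier_expand[of "A - {i}" l f x]
        sum_subtractf[symmetric] algebra_simps subset_insertI2 Diff_subset subset_trans[of "A-{i}" A])
  also have "\<dots> = (\<Sum>S\<in>?T. fourier_coeff l f x S * ?c (S - {i}) A)"
  proof (rule sum.mono_neutral_cong_right)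
    show "finite (Pow {..<l})" "?T \<subseteq> Pow {..<l}" by auto
    show "\<forall>S\<in>Pow {..<l} - ?T. fourier_coeff l f x S * (?c S (insert i A) - ?c S (A - {i})) = 0"
    proof
      fix S assume "S \<in> Pow {..<l} - ?T"
      then have "?c S (insert i A) = ?c S (A - {i})" by (intro prod.cong) auto
      then show "fourier_coeff l f x S * (?c S (insert i A) - ?c S (A - {i})) = 0" by simp
    qed
    fix S assume S: "S \<in> ?T"
    then have *: "?c S B = (of_bool (i \<in> B) - x) * ?c (S - {i}) B" for B
      using fin by (simp add: prod.remove[of S i])
    have "?c S (insert i A) = (1 - x) * ?c (S - {i}) (insert i A)"
      "?c S (A - {i}) = - x * ?c (S - {i}) (A - {i})"
      unfolding * by simp_all
    moreover have "?c (S - {i}) (insert i A) = ?c (S - {i}) A" "?c (S - {i}) (A - {i}) = ?c (S - {i}) A"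
      by (auto intro!: prod.cong)
    ultimately have "?c S (insert i A) - ?c S (A - {i}) = ?c (S - {i}) A"
      by (simp only:) (simp add: left_diff_distrib)
    then show "fourier_coeff l f x S * (?c S (insert i A) - ?c S (A - {i})) =
        fourier_coeff l f x S * ?c (S - {i}) A"
      by simp
  qed
  also have "\<dots> = (\<Sum>S\<in>?T'. fourier_coeff l f x (insert i S) * ?c S A)"
    by (rule sum.reindex_bij_witness[of _ "insert i" "\<lambda>S. S - {i}"]) (use i in \<open>auto simp: insert_absorb\<close>)
  also have "\<dots> = (\<Sum>S\<in>Pow {..<l}. (if i \<in> S then 0 else fourier_coeff l f x (insert i S)) * ?c S A)"
    by (rule sum.mono_neutral_cong_left) auto
  finally show ?thesis .
qed

text \<open>
  For monotone Boolean \<open>f\<close> the difference \<open>f (insert i A) - f (A - {i})\<close> is the indicator of the event that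
  \<open>i\<close> is pivotal. An indicator has the same expectation as its square, so its constant coefficient, which is
  \<open>fourier_coeff l f x {i}\<close>, equals its sum of squares.
\<close>

lemma influence_parseval:
  assumes "boolean_monotone l f" "i < l"
  shows "(\<Sum>S\<in>{S. S \<subseteq> {..<l} \<and> i \<in> S}. (fourier_coeff l f x S)\<^sup>2 * (x * (1 - x)) ^ (card S - 1)) =
      fourier_coeff l f x {i}"
    and "0 \<le> x \<Longrightarrow> x \<le> 1 \<Longrightarrow> 0 \<le> fourier_coeff l f x {i} \<and> fourier_coeff l f x {i} \<le> 1"
proof -
  let ?d = "\<lambda>A. f (insert i A) - f (A - {i})"
  let ?b = "\<lambda>S. if i \<in> S then 0 else fourier_coeff l f x (insert i S)"
  note P = parseval[of l ?d ?b x, OF discrete_derivative_expand[OF assms(2)]]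
  have d: "?d A \<in> {0,1}" if "A \<subseteq> {..<l}" for A
  proof -
    have "insert i A \<subseteq> {..<l}" "A - {i} \<subseteq> {..<l}" "A - {i} \<subseteq> insert i A"
      using that assms(2) by auto
    then have "f (insert i A) \<in> {0,1}" "f (A - {i}) \<in> {0,1}" "f (A - {i}) \<le> f (insert i A)"
      using assms(1) unfolding boolean_monotone_def by blast+
    then show ?thesis by auto
  qed
  have fin: "finite S" if "S \<subseteq> {..<l}" for S using that finite_subset by blast
  have "fourier_coeff l f x {i} = multilinear l ?d (\<lambda>_. x)" using P(2) by simp
  also have "\<dots> = multilinear l (\<lambda>A. (?d A)\<^sup>2) (\<lambda>_. x)"
  proof (intro multilinear_cong refl)
    fix A assume "A \<subseteq> {..<l}"
    from d[OF this] show "?d A = (?d A)\<^sup>2" by (elim insertE emptyE) simp_all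
  qed
  also have "\<dots> = (\<Sum>S\<in>Pow {..<l}. (?b S)\<^sup>2 * (x * (1 - x)) ^ card S)" by (rule P(1))
  also have "\<dots> = (\<Sum>S\<in>{S. S \<subseteq> {..<l} \<and> i \<notin> S}. (fourier_coeff l f x (insert i S))\<^sup>2 * (x * (1 - x)) ^ card S)"
    by (rule sum.mono_neutral_cong_right) auto
  also have "\<dots> = (\<Sum>S\<in>{S. S \<subseteq> {..<l} \<and> i \<in> S}. (fourier_coeff l f x S)\<^sup>2 * (x * (1 - x)) ^ (card S - 1))"
    by (rule sum.reindex_bij_witness[of _ "\<lambda>S. S - {i}" "insert i"])
       (use assms(2) fin in \<open>auto simp: insert_absorb\<close>)
  finally show "(\<Sum>S\<in>{S. S \<subseteq> {..<l} \<and> i \<in> S}. (fourier_coeff l f x S)\<^sup>2 * (x * (1 - x)) ^ (card S - 1)) =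
      fourier_coeff l f x {i}" ..
  assume x: "0 \<le> x" "x \<le> 1"
  have c: "fourier_coeff l f x {i} = multilinear l ?d (\<lambda>_. x)" using P(2) by simp
  show "0 \<le> fourier_coeff l f x {i} \<and> fourier_coeff l f x {i} \<le> 1"
  proof -
    have "0 \<le> ?d A \<and> ?d A \<le> 1" if "A \<subseteq> {..<l}" for A
      using d[OF that] by (elim insertE emptyE) simp_all
    then show ?thesis
      using multilinear_mono[of l "\<lambda>_. 0" ?d "\<lambda>_. x"] multilinear_mono[of l ?d "\<lambda>_. 1" "\<lambda>_. x"] x
      unfolding c multilinear_const by blast
  qed
qed

text \<open>
  The left-hand side is the derivative of \<open>\<lambda>c. \<Sum>S. (fourier_coeff l f x S)\<^sup>2 * c ^ card S\<close> at
  \<open>c = x * (1 - x)\<close>. By \<open>multilinear_DERIV\<close>, the right-hand side is the derivative of the expectation of \<open>f\<close>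
  with respect to the bias.
\<close>

lemma total_influence_parseval:
  assumes "boolean_monotone l f"
  shows "(\<Sum>S\<in>Pow {..<l}. real (card S) * (fourier_coeff l f x S)\<^sup>2 * (x * (1 - x)) ^ (card S - 1)) =
    (\<Sum>i<l. fourier_coeff l f x {i})"
proof -
  let ?t = "\<lambda>S. (fourier_coeff l f x S)\<^sup>2 * (x * (1 - x)) ^ (card S - 1)"
  have "(\<Sum>i<l. fourier_coeff l f x {i}) = (\<Sum>i<l. \<Sum>S\<in>Pow {..<l}. if i \<in> S then ?t S else 0)"
  proof (rule sum.cong[OF refl])
    fix i assume "i \<in> {..<l}"
    then have "fourier_coeff l f x {i} = (\<Sum>S\<in>{S. S \<subseteq> {..<l} \<and> i \<in> S}. ?t S)"
      using influence_parseval(1)[OF assms, of i x] by simp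
    also have "\<dots> = (\<Sum>S\<in>Pow {..<l}. if i \<in> S then ?t S else 0)"
      by (rule sum.mono_neutral_cong_left) auto
    finally show "fourier_coeff l f x {i} = (\<Sum>S\<in>Pow {..<l}. if i \<in> S then ?t S else 0)" .
  qed
  also have "\<dots> = (\<Sum>S\<in>Pow {..<l}. \<Sum>i<l. if i \<in> S then ?t S else 0)"
    by (rule sum.swap)
  also have "\<dots> = (\<Sum>S\<in>Pow {..<l}. real (card S) * ?t S)"
  proof (intro sum.cong refl)
    fix S assume "S \<in> Pow {..<l}"
    then have "{..<l} \<inter> S = S" by auto
    then show "(\<Sum>i<l. if i \<in> S then ?t S else 0) = real (card S) * ?t S"
      by (simp add: sum.If_cases)
  qed
  finally show ?thesis by (simp add: mult_ac)
qed

text \<open>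
  The Margulis--Russo formula. On the diagonal the expansion around \<open>x\<close> is a polynomial in \<open>y - x\<close>, and only
  the singletons contribute to its linear term.
\<close>

lemma multilinear_DERIV:
  "((\<lambda>y. multilinear l f (\<lambda>_. y)) has_real_derivative (\<Sum>i<l. fourier_coeff l f x {i})) (at x)"
proof -
  have "((\<lambda>y. \<Sum>S\<in>Pow {..<l}. fourier_coeff l f x S * (y - x) ^ card S) has_real_derivative
      (\<Sum>S\<in>Pow {..<l}. fourier_coeff l f x S * (real (card S) * 0 ^ (card S - 1)))) (at x)"
    by (auto intro!: derivative_eq_intros sum.cong simp: mult_ac)
  moreover have "(\<lambda>y. multilinear l f (\<lambda>_. y)) = (\<lambda>y. \<Sum>S\<in>Pow {..<l}. fourier_coeff l f x S * (y - x) ^ card S)"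
    by (simp add: multilinear_expand[of l f _ x])
  moreover have "(\<Sum>S\<in>Pow {..<l}. fourier_coeff l f x S * (real (card S) * 0 ^ (card S - 1))) =
      (\<Sum>S\<in>(\<lambda>i. {i}) ` {..<l}. fourier_coeff l f x S)"
  proof (rule sum.mono_neutral_cong_right)
    show "\<forall>S\<in>Pow {..<l} - (\<lambda>i. {i}) ` {..<l}. fourier_coeff l f x S * (real (card S) * 0 ^ (card S - 1)) = 0"
    proof
      fix S assume S: "S \<in> Pow {..<l} - (\<lambda>i. {i}) ` {..<l}"
      then have "card S \<noteq> 1" by (auto simp: card_1_singleton_iff)
      then show "fourier_coeff l f x S * (real (card S) * 0 ^ (card S - 1)) = 0"
        by (cases "card S = 0") (auto simp: power_0_left)
    qed
  qed auto
  ultimately show ?thesis by (simp add: sum.reindex)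
qed

definition threshold :: "nat \<Rightarrow> nat set \<Rightarrow> real" where
  "threshold k A = of_bool (k \<le> card A)"

lemma boolean_monotone_threshold: "boolean_monotone l (threshold k)"
  unfolding boolean_monotone_def threshold_def
  by (auto intro: order_trans[OF _ card_mono] finite_subset[OF _ finite_lessThan])

text \<open>
  If all coefficients of order at least 2 vanished, then whether coordinate 0 is pivotal would not depend on
  the other coordinates. It is pivotal exactly if \<open>k - 1\<close> of the other coordinates belong to the set; as
  there are \<open>l - 1 \<ge> 1\<close> of them, this number can be attained and can also be missed.
\<close>

lemma threshold_nonlinear:
  assumes "2 \<le> l" "1 \<le> k" "k \<le> l"
  obtains S where "S \<subseteq> {..<l}" "2 \<le> card S" "fourier_coeff l (threshold k) x S \<noteq> 0"
proof -
  have "\<exists>S. S \<subseteq> {..<l} \<and> 2 \<le> card S \<and> fourier_coeff l (threshold k) x S \<noteq> 0"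
  proof (rule ccontr)
    assume "\<not> ?thesis"
    then have *: "fourier_coeff l (threshold k) x S = 0" if "S \<subseteq> {..<l}" "2 \<le> card S" for S using that by blast
    have fin: "finite S" if "S \<subseteq> {..<l}" for S using that finite_subset by blast
    have l: "0 < l" using assms by simp
    have c: "threshold k (insert 0 A) - threshold k (A - {0}) = fourier_coeff l (threshold k) x {0}"
        if A: "A \<subseteq> {..<l}" for A
    proof -
      have "(if 0 \<in> S then 0 else fourier_coeff l (threshold k) x (insert 0 S)) = 0"
          if "S \<in> Pow {..<l} - {{}}" for S
        using that l fin[of S] by (auto intro!: * simp: card_insert_if Suc_le_eq card_gt_0_iff)
      then show ?thesis
        using discrete_derivative_expand[OF l A, of "threshold k" x]
        by (subst (asm) sum.mono_neutral_cong_right[where S="{{}}"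
            and h="\<lambda>_. fourier_coeff l (threshold k) x {0}"]) auto
    qed
    \<comment> \<open>coordinate 0 is pivotal for the set \<open>{1..m}\<close> exactly if \<open>m = k - 1\<close>;
      compare \<open>m = k - 1\<close> with another value \<open>m \<in> {0, 1}\<close>\<close>
    have cc: "threshold k (insert 0 {1..<Suc m}) - threshold k ({1..<Suc m} - {0}) = of_bool (m = k - 1)" for m
      using assms(2) by (auto simp: threshold_def)
    have "threshold k (insert 0 {1..<Suc (k-1)}) - threshold k ({1..<Suc (k-1)} - {0}) =
        fourier_coeff l (threshold k) x {0}"
      using assms by (intro c) auto
    moreover have "threshold k (insert 0 {1..<Suc (if k = 1 then 1 else 0)}) - threshold k
        ({1..<Suc (if k = 1 then 1 else 0)} - {0}) = fourier_coeff l (threshold k) x {0}"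
      using assms by (intro c) auto
    ultimately show False unfolding cc using assms by (auto split: if_splits)
  qed
  then show thesis using that by blast
qed

lemma binomial_threshold:
  assumes "0 \<le> x" "x \<le> 1"
  shows "measure_pmf.prob (binomial_pmf l x) {k..} = multilinear l (threshold k) (\<lambda>_. x)"
proof -
  have *: "(\<Prod>i<l. if i \<in> A then x else 1 - x) = x ^ card A * (1 - x) ^ (l - card A)" if "A \<subseteq> {..<l}" for A
    using that finite_subset[OF that] by (simp add: prod_if_subset card_Diff_subset)
  have "measure_pmf.prob (binomial_pmf l x) {k..} = measure_pmf.prob (binomial_pmf l x) {k..l}"
    using assms set_pmf_binomial_eq[of x l]
      by (intro measure_pmf.finite_measure_eq_AE) (auto simp: AE_measure_pmf_iff split: if_splits)
  also have "\<dots> = (\<Sum>j\<in>{k..l}. pmf (binomial_pmf l x) j)"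
    by (rule measure_measure_pmf_finite) simp
  also have "\<dots> = (\<Sum>j\<in>{k..l}. \<Sum>A\<in>{A\<in>Pow {..<l}. card A = j}. threshold k A * (\<Prod>i<l. if i \<in> A then x else 1 - x))"
  proof (rule sum.cong[OF refl])
    fix j assume j: "j \<in> {k..l}"
    have "(\<Sum>A\<in>{A\<in>Pow {..<l}. card A = j}. threshold k A * (\<Prod>i<l. if i \<in> A then x else 1 - x)) =
        (\<Sum>A\<in>{A\<in>Pow {..<l}. card A = j}. x ^ j * (1 - x) ^ (l - j))"
      using j by (intro sum.cong refl) (auto simp: * threshold_def)
    then show "pmf (binomial_pmf l x) j =
        (\<Sum>A\<in>{A\<in>Pow {..<l}. card A = j}. threshold k A * (\<Prod>i<l. if i \<in> A then x else 1 - x))"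
      using assms j n_subsets[of "{..<l}" j] by simp
  qed
  also have "\<dots> = (\<Sum>A\<in>{A\<in>Pow {..<l}. card A \<in> {k..l}}. threshold k A * (\<Prod>i<l. if i \<in> A then x else 1 - x))"
    by (subst sum.group[of "{A\<in>Pow {..<l}. card A \<in> {k..l}}" "{k..l}" card, symmetric])
       (auto intro!: sum.cong)
  also have "\<dots> = multilinear l (threshold k) (\<lambda>_. x)"
    unfolding multilinear_def
    by (rule sum.mono_neutral_left) (auto simp: threshold_def dest: card_mono[rotated])
  finally show ?thesis .
qed

section \<open>Noise stability\<close>

text \<open>
  The second moment \<open>E[f(U) f(V)]\<close> for two random sets with marginal bias \<open>x\<close>, independent over the
  coordinates and with covariance \<open>c\<close> in each coordinate.
\<close>

definition noise_stability :: "nat \<Rightarrow> (nat set \<Rightarrow> real) \<Rightarrow> real \<Rightarrow> real \<Rightarrow> real" where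
  "noise_stability l f x c = (\<Sum>S\<in>Pow {..<l}. (fourier_coeff l f x S)\<^sup>2 * c ^ card S)"

lemma power_diff_le:
  fixes a b :: real
  assumes "0 \<le> a" "a \<le> b"
  shows "b ^ k - a ^ k \<le> real k * b ^ (k - 1) * (b - a)"
    and "2 \<le> k \<Longrightarrow> a < b \<Longrightarrow> b ^ k - a ^ k < real k * b ^ (k - 1) * (b - a)"
proof -
  have le: "b ^ k - a ^ k \<le> real k * b ^ (k - 1) * (b - a)" for k
  proof (induction k)
    case (Suc k)
    have "b ^ Suc k - a ^ Suc k = b * (b ^ k - a ^ k) + a ^ k * (b - a)"
      by (simp add: algebra_simps)
    also have "\<dots> \<le> b * (real k * b ^ (k - 1) * (b - a)) + b ^ k * (b - a)"
      using assms Suc by (intro add_mono mult_left_mono mult_right_mono power_mono) auto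
    also have "\<dots> = real (Suc k) * b ^ (Suc k - 1) * (b - a)"
      by (cases k) (simp_all add: algebra_simps)
    finally show ?case .
  qed simp
  show "b ^ k - a ^ k \<le> real k * b ^ (k - 1) * (b - a)" by (rule le)
  assume "2 \<le> k" "a < b"
  then obtain j where k: "k = Suc j" "j > 0" by (cases k) auto
  have "b ^ Suc j - a ^ Suc j = b * (b ^ j - a ^ j) + a ^ j * (b - a)"
    by (simp add: algebra_simps)
  also have "\<dots> < b * (real j * b ^ (j - 1) * (b - a)) + b ^ j * (b - a)"
    using assms le[of j] k \<open>a < b\<close>
    by (intro add_le_less_mono mult_left_mono mult_strict_right_mono power_strict_mono) auto
  also have "\<dots> = real (Suc j) * b ^ (Suc j - 1) * (b - a)"
    using k by (cases j) (simp_all add: algebra_simps)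
  finally show "b ^ k - a ^ k < real k * b ^ (k - 1) * (b - a)" using k by simp
qed

definition total_influence :: "nat \<Rightarrow> (nat set \<Rightarrow> real) \<Rightarrow> real \<Rightarrow> real" where
  "total_influence l f x = (\<Sum>i<l. fourier_coeff l f x {i})"

lemma total_influence_bounds:
  assumes "boolean_monotone l f" "0 \<le> x" "x \<le> 1"
  shows "0 \<le> total_influence l f x" "total_influence l f x \<le> real l"
  using influence_parseval(2)[OF assms(1) _ assms(2,3)]
      sum_mono[of "{..<l}" "\<lambda>i. fourier_coeff l f x {i}" "\<lambda>_. 1"]
  by (auto simp: total_influence_def intro!: sum_nonneg)

lemma noise_stability_mono:
  assumes "0 \<le> a" "a \<le> b" shows "noise_stability l f x a \<le> noise_stability l f x b"
  unfolding noise_stability_def using assms by (intro sum_mono mult_left_mono power_mono) auto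

lemma noise_stability_nonneg: "0 \<le> a \<Longrightarrow> 0 \<le> noise_stability l f x a"
  unfolding noise_stability_def by (intro sum_nonneg) auto

text \<open>
  With the maximal covariance \<open>x * (1 - x)\<close> both random sets coincide, and \<open>f\<^sup>2 = f\<close>.
\<close>

lemma noise_stability_max:
  assumes "boolean_monotone l f"
  shows "noise_stability l f x (x * (1 - x)) = multilinear l f (\<lambda>_. x)"
proof -
  have "multilinear l f (\<lambda>_. x) = multilinear l (\<lambda>A. (f A)\<^sup>2) (\<lambda>_. x)"
  proof (rule multilinear_cong[OF _ refl])
    fix A assume "A \<subseteq> {..<l}"
    then have "f A \<in> {0, 1}" using assms by (simp add: boolean_monotone_def)
    then show "f A = (f A)\<^sup>2" by auto
  qed
  also have "\<dots> = noise_stability l f x (x * (1 - x))"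
    unfolding noise_stability_def by (rule parseval(1)[OF fourier_expand])
  finally show ?thesis ..
qed

text \<open>
  A polynomial with nonnegative coefficients lies above its tangent on \<open>[0, \<infinity>)\<close>, strictly so to the left of
  the point of contact if a coefficient of order at least 2 is positive.
\<close>

lemma noise_stability_convex:
  assumes f: "boolean_monotone l f" and c: "0 \<le> c" "c \<le> x * (1 - x)"
  shows "noise_stability l f x (x * (1 - x)) - noise_stability l f x c \<le>
      total_influence l f x * (x * (1 - x) - c)"
    and "c < x * (1 - x) \<Longrightarrow> S \<subseteq> {..<l} \<Longrightarrow> 2 \<le> card S \<Longrightarrow> fourier_coeff l f x S \<noteq> 0 \<Longrightarrow>
      noise_stability l f x (x * (1 - x)) - noise_stability l f x c < total_influence l f x * (x * (1 - x) - c)"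
proof -
  let ?v = "x * (1 - x)" and ?a = "fourier_coeff l f x"
  have L: "noise_stability l f x ?v - noise_stability l f x c =
      (\<Sum>S\<in>Pow {..<l}. (?a S)\<^sup>2 * (?v ^ card S - c ^ card S))"
    by (simp add: noise_stability_def sum_subtractf algebra_simps)
  have R: "total_influence l f x * (?v - c) =
      (\<Sum>S\<in>Pow {..<l}. (?a S)\<^sup>2 * (real (card S) * ?v ^ (card S - 1) * (?v - c)))"
    unfolding total_influence_def total_influence_parseval[OF f, symmetric] sum_distrib_right
      by (simp add: mult_ac)
  show "noise_stability l f x ?v - noise_stability l f x c \<le> total_influence l f x * (?v - c)"
    unfolding L R using c by (intro sum_mono mult_left_mono power_diff_le) auto
  assume "c < ?v" and S: "S \<subseteq> {..<l}" "2 \<le> card S" "?a S \<noteq> 0"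
  then show "noise_stability l f x ?v - noise_stability l f x c < total_influence l f x * (?v - c)"
    unfolding L R using c
    by (intro sum_strict_mono_ex1 ballI bexI[of _ S] mult_left_mono mult_strict_left_mono power_diff_le) auto
qed

lemma noise_stability_DERIV:
  assumes "boolean_monotone l f"
  shows "(noise_stability l f x has_real_derivative total_influence l f x) (at (x * (1 - x)))"
proof -
  have "((\<lambda>c. noise_stability l f x c) has_real_derivative
     (\<Sum>S\<in>Pow {..<l}. (fourier_coeff l f x S)\<^sup>2 * (real (card S) * (x * (1 - x)) ^ (card S - 1))))
         (at (x * (1 - x)))"
    unfolding noise_stability_def by (auto intro!: derivative_eq_intros sum.cong)
  then show ?thesis
    unfolding total_influence_def total_influence_parseval[OF assms, symmetric] by (simp add: mult_ac)
qed

section \<open>Independent offspring numbers\<close>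

abbreviation offspring :: "nat pmf \<Rightarrow> (nat list \<Rightarrow> nat) measure" where
  "offspring chi \<equiv> PiM UNIV (\<lambda>_. measure_pmf chi)"

text \<open>
  The offspring numbers in the subtree originated by the child \<open>i\<close> of the root.
\<close>

definition below :: "nat \<Rightarrow> (nat list \<Rightarrow> nat) \<Rightarrow> nat list \<Rightarrow> nat" where
  "below i N v = N (i # v)"

text \<open>
  The first \<open>n\<close> generations reproduce according to \<open>N\<close> and all later ones according to \<open>N'\<close>.
\<close>

definition graft :: "nat \<Rightarrow> (nat list \<Rightarrow> nat) \<Rightarrow> (nat list \<Rightarrow> nat) \<Rightarrow> nat list \<Rightarrow> nat" where
  "graft n N N' v = (if length v < n then N v else N' v)"

lemma product_prob_space_pmf: "product_prob_space (\<lambda>_. measure_pmf chi)"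
  by (intro product_prob_spaceI prob_space_measure_pmf)

lemma prob_space_offspring: "prob_space (offspring chi)"
  by (intro prob_space_PiM prob_space_measure_pmf)

lemma space_offspring [simp]: "space (offspring chi) = UNIV"
  by (simp add: space_PiM)

lemma measurable_coord [measurable]: "(\<lambda>N. N v) \<in> offspring chi \<rightarrow>\<^sub>M count_space UNIV"
  using measurable_component_singleton[of v UNIV "\<lambda>_. measure_pmf chi"]
  by (simp add: measurable_cong_sets[OF refl, of "measure_pmf chi" "count_space UNIV"])

lemma measurable_into_offspring:
  assumes "\<And>v. (\<lambda>x. f x v) \<in> M \<rightarrow>\<^sub>M count_space UNIV"
  shows "f \<in> M \<rightarrow>\<^sub>M offspring chi"
  by (rule measurable_PiM_single')
     (use assms in \<open>auto simp: measurable_cong_sets[OF refl, of "measure_pmf chi" "count_space UNIV"]\<close>)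

lemma measurable_below [measurable]: "below i \<in> offspring chi \<rightarrow>\<^sub>M offspring chi"
  by (rule measurable_into_offspring) (simp add: below_def measurable_coord)

lemma measurable_graft [measurable]:
  "(\<lambda>p. graft n (fst p) (snd p)) \<in> (offspring chi \<Otimes>\<^sub>M offspring chi) \<rightarrow>\<^sub>M offspring chi"
proof (rule measurable_into_offspring)
  fix v
  show "(\<lambda>p. graft n (fst p) (snd p) v) \<in> (offspring chi \<Otimes>\<^sub>M offspring chi) \<rightarrow>\<^sub>M count_space UNIV"
    by (cases "length v < n") (simp_all add: graft_def)
qed

lemma distr_below: "distr (offspring chi) (offspring chi) (below i) = offspring chi"
proof -
  have "below i = (\<lambda>N. \<lambda>v\<in>UNIV. N (i # v))"
    by (simp add: fun_eq_iff below_def)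
  then show ?thesis
    using distr_PiM_reindex[of UNIV "\<lambda>_. measure_pmf chi" "(#) i" UNIV]
    by (simp add: prob_space_measure_pmf)
qed

text \<open>
  The vertices at which the two independent families are read are disjoint, so the resulting offspring numbers
  are again independent.
\<close>

lemma distr_graft:
  "distr (offspring chi \<Otimes>\<^sub>M offspring chi) (offspring chi) (\<lambda>p. graft n (fst p) (snd p)) = offspring chi"
proof -
  interpret product_prob_space "\<lambda>_. measure_pmf chi" "UNIV :: nat list set" by (rule product_prob_space_pmf)
  show ?thesis
  proof (rule PiM_eq)
    fix J :: "nat list set" and F :: "nat list \<Rightarrow> nat set"
    assume J: "finite J"
    let ?A = "{N \<in> space (offspring chi). \<forall>v\<in>J \<inter> {v. length v < n}. N v \<in> F v}"
    let ?B = "{N \<in> space (offspring chi). \<forall>v\<in>J - {v. length v < n}. N v \<in> F v}"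
    have emb: "prod_emb UNIV (\<lambda>_. measure_pmf chi) J (\<Pi>\<^sub>E j\<in>J. F j) = {N. \<forall>v\<in>J. N v \<in> F v}"
      by (auto simp: prod_emb_def)
    have [measurable]: "{N. \<forall>v\<in>J. N v \<in> F v} \<in> sets (offspring chi)"
      unfolding emb[symmetric] using J by (intro sets_PiM_I) auto
    have "emeasure (distr (offspring chi \<Otimes>\<^sub>M offspring chi) (offspring chi) (\<lambda>p. graft n (fst p) (snd p)))
        {N. \<forall>v\<in>J. N v \<in> F v} =
      emeasure (offspring chi \<Otimes>\<^sub>M offspring chi) (?A \<times> ?B)"
      by (subst emeasure_distr[OF measurable_graft])
          (auto intro!: arg_cong2[where f=emeasure] simp: graft_def space_pair_measure split: if_splits)
    also have "\<dots> = emeasure (offspring chi) ?A * emeasure (offspring chi) ?B"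
      using J by (intro P.emeasure_pair_measure_Times) measurable
    also have "\<dots> = (\<Prod>v\<in>J \<inter> {v. length v < n}. emeasure (measure_pmf chi) (F v)) *
        (\<Prod>v\<in>J - {v. length v < n}. emeasure (measure_pmf chi) (F v))"
      using J by (intro arg_cong2[where f="(*)"] emeasure_PiM_Collect) auto
    also have "\<dots> = (\<Prod>v\<in>J. emeasure (measure_pmf chi) (F v))"
      using J by (simp add: prod.Int_Diff[symmetric])
    finally show "emeasure (distr (offspring chi \<Otimes>\<^sub>M offspring chi) (offspring chi)
        (\<lambda>p. graft n (fst p) (snd p)))
        (prod_emb UNIV (\<lambda>_. measure_pmf chi) J (\<Pi>\<^sub>E j\<in>J. F j)) = (\<Prod>v\<in>J. emeasure (measure_pmf chi) (F v))"
      unfolding emb .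
  qed simp
qed

text \<open>
  The families \<open>below i N\<close> are restrictions of \<open>N\<close> to the disjoint sets \<open>range ((#) i)\<close>.
\<close>

lemma indep_below:
  assumes "\<And>i. i < l \<Longrightarrow> f i \<in> borel_measurable (offspring chi)"
  shows "prob_space.indep_vars (offspring chi) (\<lambda>_. borel) (\<lambda>i N. f i (below i N) :: real) {..<l}"
proof -
  interpret product_prob_space "\<lambda>_. measure_pmf chi" "UNIV :: nat list set" by (rule product_prob_space_pmf)
  have "distr (offspring chi) (offspring chi) (\<lambda>N. \<lambda>v\<in>UNIV. N v) = offspring chi"
    by (simp only: restrict_UNIV distr_id2)
  then have "distr (offspring chi) (offspring chi) (\<lambda>N. \<lambda>v\<in>UNIV. N v) =
      PiM UNIV (\<lambda>v. distr (offspring chi) (measure_pmf chi) (\<lambda>N. N v))"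
    by (simp only: PiM_component[OF UNIV_I])
  moreover have "P.indep_vars (\<lambda>_. measure_pmf chi) (\<lambda>v N. N v) UNIV \<longleftrightarrow>
      distr (offspring chi) (offspring chi) (\<lambda>N. \<lambda>v\<in>UNIV. N v) =
      PiM UNIV (\<lambda>v. distr (offspring chi) (measure_pmf chi) (\<lambda>N. N v))"
    by (rule P.indep_vars_iff_distr_eq_PiM'[where M'="\<lambda>_. measure_pmf chi" and X="\<lambda>v N. N v"])
       (auto intro: measurable_component_singleton)
  ultimately have 1: "P.indep_vars (\<lambda>_. measure_pmf chi) (\<lambda>v N. N v) UNIV"
    by blast
  have 2: "P.indep_vars (\<lambda>i. PiM (range ((#) i)) (\<lambda>_. measure_pmf chi)) (\<lambda>i N. restrict N (range ((#) i)))
      {..<l}"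
    using P.indep_vars_restrict[OF 1, of "{..<l}" "\<lambda>i. range ((#) i)"]
    by (auto simp: disjoint_family_on_def)
  have 3: "(\<lambda>N. f i (below i N)) \<in> borel_measurable (PiM (range ((#) i)) (\<lambda>_. measure_pmf chi))"
      if "i < l" for i
  proof (rule measurable_compose[OF _ assms[OF that]], rule measurable_into_offspring)
    fix v
    have "(\<lambda>N. N (i # v)) \<in> PiM (range ((#) i)) (\<lambda>_. measure_pmf chi) \<rightarrow>\<^sub>M measure_pmf chi"
      by (rule measurable_component_singleton) simp
    then show "(\<lambda>N. below i N v) \<in> PiM (range ((#) i)) (\<lambda>_. measure_pmf chi) \<rightarrow>\<^sub>M count_space UNIV"
      by (simp only: below_def measurable_cong_sets[OF refl sets_measure_pmf_count_space])
  qed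
  have "P.indep_vars (\<lambda>_. borel) (\<lambda>i N. f i (below i (restrict N (range ((#) i))))) {..<l}"
    by (rule P.indep_vars_compose2[OF 2]) (use 3 in auto)
  moreover have "below i (restrict N (range ((#) i))) = below i N" for i N
    by (simp add: fun_eq_iff below_def)
  ultimately show ?thesis by simp
qed

lemma integrable_below:
  "integrable (offspring chi) f \<Longrightarrow> integrable (offspring chi) (\<lambda>N. f (below i N) :: real)"
  using integrable_distr[of "below i" "offspring chi" "offspring chi" f] by (simp add: distr_below)

lemma integral_below:
  "f \<in> borel_measurable (offspring chi) \<Longrightarrow> (\<integral>N. f (below i N) \<partial>offspring chi) = (\<integral>N. f N \<partial>offspring chi :: real)"
  using integral_distr[of "below i" "offspring chi" "offspring chi" f] by (simp add: distr_below)

lemma integral_prod_below: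
  assumes f: "\<And>i. i < l \<Longrightarrow> integrable (offspring chi) (f i)"
  shows "(\<integral>N. (\<Prod>i<l. f i (below i N)) \<partial>offspring chi) = (\<Prod>i<l. \<integral>N. f i N \<partial>offspring chi :: real)"
    and "integrable (offspring chi) (\<lambda>N. \<Prod>i<l. f i (below i N) :: real)"
proof -
  interpret prob_space "offspring chi" by (rule prob_space_offspring)
  have i: "indep_vars (\<lambda>_. borel) (\<lambda>i N. f i (below i N)) {..<l}"
    using f by (intro indep_below) auto
  show "(\<integral>N. (\<Prod>i<l. f i (below i N)) \<partial>offspring chi) = (\<Prod>i<l. \<integral>N. f i N \<partial>offspring chi)"
    using f by (subst indep_vars_lebesgue_integral[OF _ i]) (auto simp: integrable_below integral_below)
  show "integrable (offspring chi) (\<lambda>N. \<Prod>i<l. f i (below i N))"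
    using f by (intro indep_vars_integrable[OF _ i]) (auto simp: integrable_below)
qed

definition unit_valued :: "nat pmf \<Rightarrow> ((nat list \<Rightarrow> nat) \<Rightarrow> real) \<Rightarrow> bool" where
  "unit_valued chi Y \<longleftrightarrow> Y \<in> borel_measurable (offspring chi) \<and> (\<forall>N. 0 \<le> Y N \<and> Y N \<le> 1)"

lemma unit_valued_integrable:
  assumes "unit_valued chi Y" shows "integrable (offspring chi) Y"
proof -
  interpret prob_space "offspring chi" by (rule prob_space_offspring)
  show ?thesis using assms by (intro integrable_const_bound[of _ 1]) (auto simp: unit_valued_def abs_of_nonneg)
qed

lemma unit_valued_mult: "unit_valued chi Y \<Longrightarrow> unit_valued chi Z \<Longrightarrow> unit_valued chi (\<lambda>N. Y N * Z N)"
  by (auto simp: unit_valued_def mult_le_one)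

lemma integral_multilinear_below:
  assumes "\<And>i. i < l \<Longrightarrow> unit_valued chi (Y i)"
  shows "(\<integral>N. multilinear l f (\<lambda>i. Y i (below i N)) \<partial>offspring chi) =
      multilinear l f (\<lambda>i. \<integral>N. Y i N \<partial>offspring chi)"
proof -
  interpret prob_space "offspring chi" by (rule prob_space_offspring)
  have I: "integrable (offspring chi) (\<lambda>N. if i \<in> A then Y i N else 1 - Y i N)" if "i < l" for A i
    using unit_valued_integrable[OF assms[OF that]] by (cases "i \<in> A") simp_all
  have E: "(\<integral>N. (if i \<in> A then Y i N else 1 - Y i N) \<partial>offspring chi) =
      (if i \<in> A then \<integral>N. Y i N \<partial>offspring chi else 1 - (\<integral>N. Y i N \<partial>offspring chi))" if "i < l" for A i
    using unit_valued_integrable[OF assms[OF that]] by (simp add: prob_space[simplified])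
  note P = integral_prod_below[of l chi "\<lambda>i N. if i \<in> A then Y i N else 1 - Y i N" for A, OF I]
  have "(\<integral>N. multilinear l f (\<lambda>i. Y i (below i N)) \<partial>offspring chi) =
     (\<Sum>A\<in>Pow {..<l}. f A * (\<integral>N. (\<Prod>i<l. if i \<in> A then Y i (below i N) else 1 - Y i (below i N)) \<partial>offspring chi))"
    unfolding multilinear_def using P(2) by (subst Bochner_Integration.integral_sum) auto
  also have "\<dots> = multilinear l f (\<lambda>i. \<integral>N. Y i N \<partial>offspring chi)"
    unfolding multilinear_def by (intro sum.cong refl arg_cong2[where f="(*)"]) (simp add: P(1) E)
  finally show ?thesis .
qed

text \<open>
  Orthogonality: after expansion of both factors, the product for \<open>S\<close> and \<open>S'\<close> has expectation 0 unless
  \<open>S = S'\<close>, in which case each index contributes the covariance of \<open>Y\<close> and \<open>Z\<close>.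
\<close>

lemma integral_multilinear_mult_below:
  assumes Y: "unit_valued chi Y" "(\<integral>N. Y N \<partial>offspring chi) = x"
      and Z: "unit_valued chi Z" "(\<integral>N. Z N \<partial>offspring chi) = x"
  shows "(\<integral>N. multilinear l f (\<lambda>i. Y (below i N)) * multilinear l f (\<lambda>i. Z (below i N)) \<partial>offspring chi) =
    noise_stability l f x ((\<integral>N. Y N * Z N \<partial>offspring chi) - x\<^sup>2)"
proof -
  interpret prob_space "offspring chi" by (rule prob_space_offspring)
  let ?c = "(\<integral>N. Y N * Z N \<partial>offspring chi) - x\<^sup>2"
  let ?a = "fourier_coeff l f x"
  let ?g = "\<lambda>S S' i N. (if i \<in> S then Y N - x else 1) * (if i \<in> S' then Z N - x else 1)"
  note [simp] = unit_valued_integrable[OF Y(1)] unit_valued_integrable[OF Z(1)]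
      unit_valued_integrable[OF unit_valued_mult[OF Y(1) Z(1)]]
  have eq: "?g S S' i N = (if i \<in> S then if i \<in> S' then Y N * Z N - x * Y N - x * Z N + x * x else Y N - x
      else if i \<in> S' then Z N - x else 1)" for S S' i N
    by (simp add: algebra_simps)
  have I: "integrable (offspring chi) (?g S S' i)" for S S' i
    unfolding eq by (cases "i \<in> S"; cases "i \<in> S'") simp_all
  have E: "(\<integral>N. ?g S S' i N \<partial>offspring chi) =
      (if i \<in> S then (if i \<in> S' then ?c else 0) else (if i \<in> S' then 0 else 1))" for S S' i
    unfolding eq by (auto simp: Y(2) Z(2) prob_space[simplified] power2_eq_square)
  have P: "(\<integral>N. (\<Prod>i<l. ?g S S' i (below i N)) \<partial>offspring chi) = (\<Prod>i<l. \<integral>N. ?g S S' i N \<partial>offspring chi)"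
    "integrable (offspring chi) (\<lambda>N. \<Prod>i<l. ?g S S' i (below i N))" for S S'
    using integral_prod_below[of l chi "?g S S'", OF I] by auto
  have "(\<integral>N. multilinear l f (\<lambda>i. Y (below i N)) * multilinear l f (\<lambda>i. Z (below i N)) \<partial>offspring chi) =
    (\<integral>N. (\<Sum>S\<in>Pow {..<l}. \<Sum>S'\<in>Pow {..<l}. ?a S * ?a S' * (\<Prod>i<l. ?g S S' i (below i N))) \<partial>offspring chi)"
    unfolding multilinear_expand[of l f _ x] sum_product
    by (intro Bochner_Integration.integral_cong refl sum.cong)
       (simp add: prod_pair[symmetric] mult_ac)
  also have "\<dots> = (\<Sum>S\<in>Pow {..<l}. \<Sum>S'\<in>Pow {..<l}. ?a S * ?a S' *
      (\<integral>N. (\<Prod>i<l. ?g S S' i (below i N)) \<partial>offspring chi))"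
    using P(2) by (simp add: Bochner_Integration.integral_sum)
  also have "\<dots> = (\<Sum>S\<in>Pow {..<l}. \<Sum>S'\<in>Pow {..<l}. ?a S * ?a S' * (if S = S' then ?c ^ card S else 0))"
    unfolding P(1) E by (intro sum.cong refl) (simp add: prod_orth)
  also have "\<dots> = noise_stability l f x ?c"
    by (subst sum_diagonal) (auto simp: noise_stability_def power2_eq_square)
  finally show ?thesis .
qed

lemma integral_graft:
  assumes "unit_valued chi G"
  shows "(\<integral>N. G N \<partial>offspring chi) = (\<integral>N. \<integral>N'. G (graft n N N') \<partial>offspring chi \<partial>offspring chi)"
    and "integrable (offspring chi \<Otimes>\<^sub>M offspring chi) (\<lambda>p. G (graft n (fst p) (snd p)))"
proof -
  interpret prob_space "offspring chi" by (rule prob_space_offspring)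
  interpret PP: pair_prob_space "offspring chi" "offspring chi" ..
  have [measurable]: "G \<in> borel_measurable (offspring chi)" using assms by (simp add: unit_valued_def)
  show I: "integrable (offspring chi \<Otimes>\<^sub>M offspring chi) (\<lambda>p. G (graft n (fst p) (snd p)))"
    using assms by (intro PP.P.integrable_const_bound[of _ 1]) (auto simp: unit_valued_def abs_of_nonneg)
  have "(\<integral>N. G N \<partial>offspring chi) = (\<integral>p. G (graft n (fst p) (snd p)) \<partial>(offspring chi \<Otimes>\<^sub>M offspring chi))"
    by (subst distr_graft[of chi n, symmetric], subst integral_distr) measurable
  also have "\<dots> = (\<integral>N. \<integral>N'. G (graft n N N') \<partial>offspring chi \<partial>offspring chi)"
    using PP.integral_fst'[OF I] by simp
  finally show "(\<integral>N. G N \<partial>offspring chi) = (\<integral>N. \<integral>N'. G (graft n N N') \<partial>offspring chi \<partial>offspring chi)" .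
qed

text \<open>
  One step of the recursion for functions with values in \<open>[0, 1]\<close>: the probability that the rule at the root
  is satisfied if child \<open>i\<close> has label 1 with probability \<open>Y (below i N)\<close>, independently of the others.
  For functions with values in \<open>{0, 1}\<close> this is the rule itself (\<open>step_bool\<close>).
\<close>

definition step :: "(nat \<Rightarrow> nat) \<Rightarrow> ((nat list \<Rightarrow> nat) \<Rightarrow> real) \<Rightarrow> (nat list \<Rightarrow> nat) \<Rightarrow> real" where
  "step h Y N = multilinear (N []) (threshold (h (N []))) (\<lambda>i. Y (below i N))"

lemma multilinear_threshold_01:
  assumes "\<And>i. i < l \<Longrightarrow> 0 \<le> z i \<and> z i \<le> 1"
  shows "0 \<le> multilinear l (threshold k) z \<and> multilinear l (threshold k) z \<le> 1"
  using multilinear_mono[of l "\<lambda>_. 0" "threshold k" z] multilinear_mono[of l "threshold k" "\<lambda>_. 1" z] assms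
  by (auto simp: multilinear_const threshold_def)

lemma unit_valued_step: assumes "unit_valued chi Y" shows "unit_valued chi (step h Y)"
  unfolding unit_valued_def
proof (intro conjI allI)
  have [measurable]: "Y \<in> borel_measurable (offspring chi)" using assms by (simp add: unit_valued_def)
  have "(\<lambda>N. multilinear l (threshold (h l)) (\<lambda>i. Y (below i N))) \<in> borel_measurable (offspring chi)" for l
    unfolding multilinear_def by measurable
  from measurable_compose_countable[OF this measurable_coord[of "[]"]]
  show "step h Y \<in> borel_measurable (offspring chi)" unfolding step_def[abs_def] .
  fix N show "0 \<le> step h Y N" "step h Y N \<le> 1"
    unfolding step_def using assms multilinear_threshold_01[of "N []" "\<lambda>i. Y (below i N)"]
      by (auto simp: unit_valued_def)
qed

lemma below_graft_1: "below i (graft 1 N N') = below i N'" "graft 1 N N' [] = N []"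
  by (auto simp: fun_eq_iff below_def graft_def)

lemma below_graft_Suc: "below i (graft (Suc n) N N') = graft n (below i N) (below i N')"
  by (auto simp: fun_eq_iff below_def graft_def)

lemma graft_Suc_root: "graft (Suc n) N N' [] = N []"
  by (auto simp: graft_def)

lemma integral_root: "(\<integral>N. f (N []) \<partial>offspring chi) = (\<integral>l. f l \<partial>measure_pmf chi :: real)"
proof -
  interpret product_prob_space "\<lambda>_. measure_pmf chi" "UNIV :: nat list set" by (rule product_prob_space_pmf)
  have "(\<integral>l. f l \<partial>measure_pmf chi) = (\<integral>l. f l \<partial>distr (offspring chi) (measure_pmf chi) (\<lambda>N. N []))"
    by (simp add: PiM_component)
  then show ?thesis by (subst (asm) integral_distr) simp_all
qed

text \<open>
  The offspring number of the root is independent of those in the subtrees of its children, here obtained from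
  \<open>graft 1\<close>, which replaces everything except the root.
\<close>

lemma integral_root_children:
  assumes "unit_valued chi G" and "\<And>N N'. G (graft 1 N N') = H (N []) N'"
  shows "(\<integral>N. G N \<partial>offspring chi) = (\<integral>l. (\<integral>N. H l N \<partial>offspring chi) \<partial>measure_pmf chi)"
  by (simp only: integral_graft(1)[OF assms(1), of 1] assms(2)
      integral_root[where f="\<lambda>l. \<integral>N. H l N \<partial>offspring chi"])

lemma integral_step:
  assumes "unit_valued chi Y" "(\<integral>N. Y N \<partial>offspring chi) = x"
  shows "(\<integral>N. step h Y N \<partial>offspring chi) = (\<integral>l. multilinear l (threshold (h l)) (\<lambda>_. x) \<partial>measure_pmf chi)"
proof -
  have "(\<integral>N. step h Y N \<partial>offspring chi) =
      (\<integral>l. (\<integral>N. multilinear l (threshold (h l)) (\<lambda>i. Y (below i N)) \<partial>offspring chi) \<partial>measure_pmf chi)"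
    by (rule integral_root_children[OF unit_valued_step[OF assms(1)]]) (simp only: step_def below_graft_1)
  then show ?thesis
    by (simp only: integral_multilinear_below[where Y="\<lambda>_. Y", OF assms(1)] assms(2))
qed

lemma integral_step_mult:
  assumes Y: "unit_valued chi Y" "(\<integral>N. Y N \<partial>offspring chi) = x"
      and Z: "unit_valued chi Z" "(\<integral>N. Z N \<partial>offspring chi) = x"
  shows "(\<integral>N. step h Y N * step h Z N \<partial>offspring chi) =
    (\<integral>l. noise_stability l (threshold (h l)) x ((\<integral>N. Y N * Z N \<partial>offspring chi) - x\<^sup>2) \<partial>measure_pmf chi)"
proof -
  have "(\<integral>N. step h Y N * step h Z N \<partial>offspring chi) =
      (\<integral>l. (\<integral>N. multilinear l (threshold (h l)) (\<lambda>i. Y (below i N)) * multilinear l (threshold (h l))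
          (\<lambda>i. Z (below i N)) \<partial>offspring chi) \<partial>measure_pmf chi)"
    by (rule integral_root_children[OF
        unit_valued_mult[OF unit_valued_step[OF Y(1)] unit_valued_step[OF Z(1)]]])
       (simp only: step_def below_graft_1)
  then show ?thesis by (simp only: integral_multilinear_mult_below[OF Y Z])
qed

section \<open>The covariance recursion\<close>

lemma pmf_expectation_sums:
  fixes f :: "nat \<Rightarrow> real"
  assumes "integrable (measure_pmf p) f"
  shows "(\<lambda>l. pmf p l * f l) sums (\<integral>l. f l \<partial>measure_pmf p)"
proof -
  have "integrable (density (count_space UNIV) (pmf p)) f"
    using assms by (simp add: measure_pmf_eq_density)
  then have "integrable (count_space UNIV) (\<lambda>l. pmf p l * f l)"
    by (subst (asm) integrable_density) (simp_all add: AE_count_space)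
  from sums_integral_count_space_nat[OF this]
  show ?thesis
    by (subst measure_pmf_eq_density) (simp add: integral_density)
qed

locale fixed_point =
  fixes chi :: "nat pmf" and h :: "nat \<Rightarrow> nat" and x0 :: real
  assumes h_pos: "\<And>l. h l \<ge> 1"
    and mean: "integrable (measure_pmf chi) (\<lambda>n. real n)"
    and nondegenerate: "\<exists>a\<in>set_pmf chi. \<exists>b\<in>set_pmf chi. a \<noteq> b"
    and x0_pos: "0 < x0" and x0_less: "x0 < 1"
    and fixed: "automaton_map chi h x0 = x0"
begin

abbreviation root_rule :: "nat \<Rightarrow> nat set \<Rightarrow> real" where "root_rule l \<equiv> threshold (h l)"
abbreviation label_var :: real where "label_var \<equiv> x0 * (1 - x0)"

text \<open>
  If two labellings of the children have means \<open>x0\<close> and covariance \<open>c\<close>, then \<open>cov_map c\<close> is the covariance of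
  the labels at the root (\<open>corr_step\<close> below).
\<close>

definition cov_map :: "real \<Rightarrow> real" where
  "cov_map c = (\<integral>l. noise_stability l (root_rule l) x0 c \<partial>measure_pmf chi) - x0\<^sup>2"

definition expected_influence :: real where "expected_influence =
    (\<integral>l. total_influence l (root_rule l) x0 \<partial>measure_pmf chi)"

text \<open>
  The variance of the conditional expectation of the root label given \<open>n\<close> generations (\<open>corr_posterior\<close>
  below). The iteration starts at 0 because nothing is known without any generation.
\<close>

definition cov :: "nat \<Rightarrow> real" where "cov n = (cov_map ^^ n) 0"

lemma label_var_pos: "0 < label_var" using x0_pos x0_less by simp

lemma multilinear_diagonal_01:
  assumes "0 \<le> x" "x \<le> 1" shows "0 \<le> multilinear l (threshold k) (\<lambda>_. x)"
      "multilinear l (threshold k) (\<lambda>_. x) \<le> 1"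
  using multilinear_threshold_01[of l "\<lambda>_. x" k] assms by auto

lemma integrable_multilinear:
  "0 \<le> x \<Longrightarrow> x \<le> 1 \<Longrightarrow> integrable (measure_pmf chi) (\<lambda>l. multilinear l (root_rule l) (\<lambda>_. x))"
  using multilinear_diagonal_01[of x] by (intro measure_pmf.integrable_const_bound[of _ 1])
      (auto simp: abs_of_nonneg)

lemma automaton_map_sums:
  "0 \<le> x \<Longrightarrow> x \<le> 1 \<Longrightarrow> (\<lambda>l. pmf chi l * multilinear l (root_rule l) (\<lambda>_. x)) sums automaton_map chi h x"
  using sums_unique[OF pmf_expectation_sums[OF integrable_multilinear, of x]]
      pmf_expectation_sums[OF integrable_multilinear, of x]
  by (simp add: automaton_map_def binomial_threshold)

lemma integral_multilinear_x0: "(\<integral>l. multilinear l (root_rule l) (\<lambda>_. x0) \<partial>measure_pmf chi) = x0"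
  using automaton_map_sums[of x0] pmf_expectation_sums[OF integrable_multilinear, of x0] x0_pos x0_less
  by (simp add: fixed sums_iff)

lemma integrable_total_influence:
  assumes "0 \<le> x" "x \<le> 1" shows "integrable (measure_pmf chi) (\<lambda>l. total_influence l (root_rule l) x)"
  by (rule Bochner_Integration.integrable_bound[OF mean])
     (use total_influence_bounds[OF boolean_monotone_threshold assms] in \<open>auto simp: abs_of_nonneg\<close>)

text \<open>
  The series is differentiated term by term: its \<open>l\<close>-th term is Lipschitz with constant
  \<open>pmf chi l * real l\<close>, since at most \<open>l\<close> children are pivotal, and these constants are summable because
  \<open>chi\<close> has finite expectation.
\<close>

lemma deriv_automaton_map: "deriv (automaton_map chi h) x0 = expected_influence"
proof -
  have L: "\<bar>multilinear l (root_rule l) (\<lambda>_. x) - multilinear l (root_rule l) (\<lambda>_. y)\<bar> \<le> real l * \<bar>x - y\<bar>"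
    if "x \<in> {0<..<1}" "y \<in> {0<..<1}" for l x y
    using that
  proof (intro field_differentiable_bound[where S="{0<..<1}" and f="\<lambda>y. multilinear l (root_rule l) (\<lambda>_. y)"
        and f'="\<lambda>z. total_influence l (root_rule l) z", unfolded real_norm_def])
    fix z :: real assume "z \<in> {0<..<1}"
    then show "\<bar>total_influence l (root_rule l) z\<bar> \<le> real l"
      using total_influence_bounds[OF boolean_monotone_threshold, of z l "h l"] by simp
  qed (auto simp: total_influence_def intro!: DERIV_subset[OF multilinear_DERIV])
  have "DERIV (\<lambda>x. suminf (\<lambda>l. pmf chi l * multilinear l (root_rule l) (\<lambda>_. x))) x0 :>
      (\<Sum>l. pmf chi l * total_influence l (root_rule l) x0)"
  proof (rule DERIV_series'[where a=0 and b=1 and L="\<lambda>l. pmf chi l * real l"])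
    show "DERIV (\<lambda>x. pmf chi l * multilinear l (root_rule l) (\<lambda>_. x)) x0 :>
        pmf chi l * total_influence l (root_rule l) x0" for l
      unfolding total_influence_def by (intro DERIV_cmult multilinear_DERIV)
    show "summable (\<lambda>l. pmf chi l * multilinear l (root_rule l) (\<lambda>_. x))" if "x \<in> {0<..<1}" for x
      using that automaton_map_sums[of x] by (auto simp: sums_iff)
    show "summable (\<lambda>l. pmf chi l * total_influence l (root_rule l) x0)"
      using pmf_expectation_sums[OF integrable_total_influence[of x0]] x0_pos x0_less by (auto simp: sums_iff)
    show "summable (\<lambda>l. pmf chi l * real l)"
      using pmf_expectation_sums[OF mean] by (auto simp: sums_iff)
    show "\<bar>pmf chi n * multilinear n (root_rule n) (\<lambda>_. x) - pmf chi n * multilinear n (root_rule n)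
        (\<lambda>_. y)\<bar> \<le> pmf chi n * real n * \<bar>x - y\<bar>"
      if "x \<in> {0<..<1}" "y \<in> {0<..<1}" for n x y
      using mult_left_mono[OF L[OF that], of "pmf chi n" n]
      by (simp add: right_diff_distrib[symmetric] abs_mult)
  qed (use x0_pos x0_less in auto)
  moreover have "(\<Sum>l. pmf chi l * total_influence l (root_rule l) x0) = expected_influence"
    using pmf_expectation_sums[OF integrable_total_influence[of x0]] x0_pos x0_less
      by (auto simp: sums_iff expected_influence_def)
  moreover have "eventually (\<lambda>x. suminf (\<lambda>l. pmf chi l * multilinear l (root_rule l) (\<lambda>_. x)) =
      automaton_map chi h x) (nhds x0)"
    using eventually_nhds_in_open[of "{0<..<1}" x0] x0_pos x0_less automaton_map_sums
    by (auto elim!: eventually_mono simp: sums_iff)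
  ultimately have "DERIV (automaton_map chi h) x0 :> expected_influence"
    using DERIV_cong_ev[OF refl, of "\<lambda>x. suminf (\<lambda>l. pmf chi l * multilinear l (root_rule l) (\<lambda>_. x))"
        "automaton_map chi h" x0 _ expected_influence]
    by simp
  then show ?thesis by (rule DERIV_imp_deriv)
qed

lemma noise_stability_bounds:
  assumes "0 \<le> c" "c \<le> label_var"
  shows "0 \<le> noise_stability l (root_rule l) x0 c" "noise_stability l (root_rule l) x0 c \<le> 1"
  using noise_stability_nonneg[OF assms(1)] noise_stability_mono[OF assms, of l "root_rule l" x0]
      noise_stability_max[OF boolean_monotone_threshold, of l "h l" x0]
    multilinear_diagonal_01[of x0 l "h l"] x0_pos x0_less by (auto intro: order_trans)

lemma integrable_noise_stability:
  assumes "0 \<le> c" "c \<le> label_var"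
    shows "integrable (measure_pmf chi) (\<lambda>l. noise_stability l (root_rule l) x0 c)"
  using noise_stability_bounds[OF assms] by (intro measure_pmf.integrable_const_bound[of _ 1])
      (auto simp: abs_of_nonneg)

lemma cov_map_label_var: "cov_map label_var = label_var"
  unfolding cov_map_def noise_stability_max[OF boolean_monotone_threshold] integral_multilinear_x0
  by (simp add: algebra_simps power2_eq_square)

lemma cov_map_mono: "0 \<le> a \<Longrightarrow> a \<le> b \<Longrightarrow> b \<le> label_var \<Longrightarrow> cov_map a \<le> cov_map b"
  unfolding cov_map_def by (intro diff_right_mono integral_mono integrable_noise_stability
      noise_stability_mono) auto

text \<open>
  The constant terms \<open>S = {}\<close> average to at least \<open>x0\<^sup>2\<close> because their square roots average to \<open>x0\<close>.
\<close>

lemma cov_map_nonneg: assumes "0 \<le> a" "a \<le> label_var" shows "0 \<le> cov_map a"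
proof -
  let ?u = "\<lambda>l. multilinear l (root_rule l) (\<lambda>_. x0)"
  have u: "noise_stability l (root_rule l) x0 a \<ge> (?u l)\<^sup>2" for l
  proof -
    have "(?u l)\<^sup>2 = (\<Sum>S\<in>{{}}. (fourier_coeff l (root_rule l) x0 S)\<^sup>2 * a ^ card S)"
      by (simp add: multilinear_diagonal)
    also have "\<dots> \<le> noise_stability l (root_rule l) x0 a"
      unfolding noise_stability_def using assms by (intro sum_mono2) auto
    finally show ?thesis .
  qed
  have "x0\<^sup>2 \<le> (\<integral>l. (?u l)\<^sup>2 \<partial>measure_pmf chi)"
  proof -
    have i: "integrable (measure_pmf chi) ?u" using x0_pos x0_less by (intro integrable_multilinear) auto
    have i2: "integrable (measure_pmf chi) (\<lambda>l. (?u l)\<^sup>2)"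
      using x0_pos x0_less multilinear_diagonal_01[of x0]
      by (intro measure_pmf.integrable_const_bound[of _ 1]) (auto simp: abs_of_nonneg power_le_one)
    have "0 \<le> (\<integral>l. (?u l - x0)\<^sup>2 \<partial>measure_pmf chi)" by simp
    also have "\<dots> = (\<integral>l. (?u l)\<^sup>2 - 2 * x0 * ?u l + x0\<^sup>2 \<partial>measure_pmf chi)"
      by (simp add: power2_diff algebra_simps)
    also have "\<dots> = (\<integral>l. (?u l)\<^sup>2 \<partial>measure_pmf chi) - x0\<^sup>2"
      using i i2 by (simp add: integral_multilinear_x0 power2_eq_square)
    finally show ?thesis by simp
  qed
  also have "\<dots> \<le> (\<integral>l. noise_stability l (root_rule l) x0 a \<partial>measure_pmf chi)"
    using x0_pos x0_less multilinear_diagonal_01[of x0] u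
    by (intro integral_mono integrable_noise_stability assms measure_pmf.integrable_const_bound[of _ 1])
       (auto simp: abs_of_nonneg power_le_one)
  finally show ?thesis by (simp add: cov_map_def)
qed

lemma cov_0: "cov 0 = 0" and cov_Suc: "cov (Suc n) = cov_map (cov n)"
  by (simp_all add: cov_def)

lemma cov_bounds: "0 \<le> cov n \<and> cov n \<le> label_var"
proof (induction n)
  case 0 then show ?case using label_var_pos by (simp add: cov_0)
next
  case (Suc n) then show ?case using cov_map_nonneg[of "cov n"] cov_map_mono[of "cov n" label_var]
      cov_map_label_var by (auto simp: cov_Suc)
qed

lemma incseq_cov: "incseq cov"
proof (rule incseq_SucI)
  fix n show "cov n \<le> cov (Suc n)"
  proof (induction n)
    case 0 then show ?case using cov_bounds[of 1] by (simp add: cov_0)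
  next
    case (Suc n) then show ?case using cov_map_mono[of "cov n" "cov (Suc n)"] cov_bounds
        cov_bounds[of "Suc n"] by (simp add: cov_Suc)
  qed
qed

lemma cov_map_tendsto:
  assumes "\<And>n. 0 \<le> a n \<and> a n \<le> label_var" "a \<longlonglongrightarrow> L"
  shows "(\<lambda>n. cov_map (a n)) \<longlonglongrightarrow> cov_map L"
  unfolding cov_map_def
proof (intro tendsto_diff tendsto_const integral_dominated_convergence[where w="\<lambda>_. 1"])
  show "AE l in measure_pmf chi. (\<lambda>n. noise_stability l (root_rule l) x0 (a n)) \<longlonglongrightarrow> noise_stability l
      (root_rule l) x0 L"
    unfolding noise_stability_def by (intro AE_I2 tendsto_intros assms)
  show "AE l in measure_pmf chi. norm (noise_stability l (root_rule l) x0 (a n)) \<le> 1" for n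
    using assms(1) noise_stability_bounds[of "a n"] by (auto simp: abs_of_nonneg)
qed auto

text \<open>
  The limit \<open>L\<close> of the increasing sequence is a fixed point of the convex function \<open>cov_map\<close>. A fixed point
  \<open>L < label_var\<close> besides \<open>label_var\<close> and a slope of at most 1 at \<open>label_var\<close> leave only the possibility that
  \<open>cov_map\<close> is affine on \<open>[L, label_var]\<close>. Then no rule for a possible number of children has terms of order
  at least 2, so it is either unsatisfiable or the rule of a single child, which is satisfied with
  probability \<open>x0\<close>. As the average over all rules is \<open>x0\<close>, there is almost surely exactly one child.
\<close>

lemma cov_tendsto:
  assumes "expected_influence \<le> 1" shows "cov \<longlonglongrightarrow> label_var"
proof -
  obtain L where L: "cov \<longlonglongrightarrow> L"
    using incseq_convergent[OF incseq_cov, of label_var] cov_bounds by blast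
  have Lb: "0 \<le> L" "L \<le> label_var"
    using LIMSEQ_le_const[OF L] LIMSEQ_le_const2[OF L] cov_bounds by blast+
  have "(\<lambda>n. cov_map (cov n)) \<longlonglongrightarrow> cov_map L" by (rule cov_map_tendsto[OF cov_bounds L])
  moreover have "(\<lambda>n. cov_map (cov n)) \<longlonglongrightarrow> L" using LIMSEQ_Suc[OF L] by (simp add: cov_Suc)
  ultimately have gL: "cov_map L = L" by (rule LIMSEQ_unique)
  have "L = label_var"
  proof (rule ccontr)
    assume "L \<noteq> label_var"
    with Lb have less: "L < label_var" by simp
    \<comment> \<open>the gap between the tangent at \<open>label_var\<close> and the graph, evaluated at \<open>L\<close>\<close>
    let ?e = "\<lambda>l. total_influence l (root_rule l) x0 * (label_var - L) -
        (noise_stability l (root_rule l) x0 label_var - noise_stability l (root_rule l) x0 L)"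
    have x01: "0 \<le> x0" "x0 \<le> 1" using x0_pos x0_less by auto
    have i: "integrable (measure_pmf chi) ?e"
      using Lb label_var_pos x01 by (intro Bochner_Integration.integrable_diff integrable_mult_left
          integrable_noise_stability integrable_total_influence) auto
    have nn: "0 \<le> ?e l" for l using noise_stability_convex(1)[OF boolean_monotone_threshold Lb, of l "h l"]
      by simp
    have "integral\<^sup>L (measure_pmf chi) ?e =
        expected_influence * (label_var - L) - (cov_map label_var - cov_map L)"
      using Lb label_var_pos x01 by (simp add: integrable_noise_stability integrable_total_influence
          expected_influence_def cov_map_def)
    also have "\<dots> = (expected_influence - 1) * (label_var - L)" using gL cov_map_label_var
      by (simp add: algebra_simps)
    also have "\<dots> \<le> 0" using assms less by (simp add: mult_nonpos_nonneg)
    finally have "integral\<^sup>L (measure_pmf chi) ?e = 0"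
      using Bochner_Integration.integral_nonneg[of "measure_pmf chi" ?e] nn by (intro antisym) auto
    then have z: "?e l = 0" if "l \<in> set_pmf chi" for l
      using integral_nonneg_eq_0_iff_AE[OF i] nn that by (auto simp: AE_measure_pmf_iff)
    have one: "multilinear l (root_rule l) (\<lambda>_. x0) \<le> x0 * of_bool (l = 1)" if l: "l \<in> set_pmf chi" for l
    proof (cases "h l \<le> l")
      case True
      have "\<not> 2 \<le> l"
      proof
        assume "2 \<le> l"
        with True obtain S where "S \<subseteq> {..<l}" "2 \<le> card S" "fourier_coeff l (root_rule l) x0 S \<noteq> 0"
          using threshold_nonlinear[of l "h l" x0] h_pos by auto
        from noise_stability_convex(2)[OF boolean_monotone_threshold Lb less this] z[OF l] show False by simp
      qed
      with True h_pos[of l] have "l = 1" "h l = 1" by auto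
      then show ?thesis by (simp add: multilinear_def Pow_insert threshold_def lessThan_Suc)
    next
      case False
      have "threshold (h l) A = 0" if "A \<subseteq> {..<l}" for A
        using card_mono[OF finite_lessThan that] False by (simp add: threshold_def)
      then have "multilinear l (root_rule l) (\<lambda>_. x0) = multilinear l (\<lambda>_. 0) (\<lambda>_. x0)"
        by (intro multilinear_cong refl)
      then show ?thesis using x0_pos by (simp add: multilinear_const)
    qed
    have le: "multilinear l (root_rule l) (\<lambda>_. x0) \<le> x0" if "l \<in> set_pmf chi" for l
      using one[OF that] x0_pos by (cases "l = 1") auto
    have "(\<integral>l. x0 - multilinear l (root_rule l) (\<lambda>_. x0) \<partial>measure_pmf chi) = 0"
      using integrable_multilinear[OF x01] by (simp add: integral_multilinear_x0)
    then have "AE l in measure_pmf chi. x0 - multilinear l (root_rule l) (\<lambda>_. x0) = 0"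
      using integrable_multilinear[OF x01] le
      by (subst (asm) integral_nonneg_eq_0_iff_AE) (auto simp: AE_measure_pmf_iff)
    then have "l = 1" if "l \<in> set_pmf chi" for l
      using one[OF that] that x0_pos by (cases "l = 1") (auto simp: AE_measure_pmf_iff)
    then show False using nondegenerate by auto
  qed
  then show ?thesis using L by simp
qed

text \<open>
  If the slope at \<open>label_var\<close> exceeded 1, then \<open>cov_map c < c\<close> for some \<open>c < label_var\<close>, and by monotonicity
  the iterates started at 0 could never pass \<open>c\<close>.
\<close>

lemma expected_influence_le_1:
  assumes "cov \<longlonglongrightarrow> label_var" shows "expected_influence \<le> 1"
proof (rule ccontr)
  assume "\<not> expected_influence \<le> 1"
  have x01: "0 \<le> x0" "x0 \<le> 1" using x0_pos x0_less by auto
  define e where "e k = label_var / real (k + 2)" for k :: nat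
  have e: "0 < e k" "e k \<le> label_var" for k using label_var_pos
    by (auto simp: e_def divide_simps mult_le_cancel_left1)
  have "e \<longlonglongrightarrow> 0" unfolding e_def by (rule LIMSEQ_ignore_initial_segment[where k=2, OF lim_const_over_n])
  then have e': "filterlim (\<lambda>k. - e k) (at 0) sequentially"
    using e(1) tendsto_minus[of e 0] by (simp add: filterlim_at less_imp_neq[symmetric])
  \<comment> \<open>slopes of secants ending at \<open>label_var\<close>, bounded by the slope of the tangent and hence by \<open>l\<close>\<close>
  let ?q = "\<lambda>k l. (noise_stability l (root_rule l) x0 label_var - noise_stability l (root_rule l) x0
      (label_var - e k)) / e k"
  have "(\<lambda>k. \<integral>l. ?q k l \<partial>measure_pmf chi) \<longlonglongrightarrow> (\<integral>l. total_influence l (root_rule l) x0 \<partial>measure_pmf chi)"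
  proof (intro integral_dominated_convergence[where w="\<lambda>l. real l"] mean)
    show "AE l in measure_pmf chi. (\<lambda>k. ?q k l) \<longlonglongrightarrow> total_influence l (root_rule l) x0"
    proof (rule AE_I2)
      fix l
      have "((\<lambda>t. (noise_stability l (root_rule l) x0 (label_var + t) - noise_stability l (root_rule l) x0
          label_var) / t) \<longlongrightarrow> total_influence l (root_rule l) x0) (at 0)"
        using noise_stability_DERIV[OF boolean_monotone_threshold, of l "h l" x0] by (simp add: DERIV_def)
      from filterlim_compose[OF this e'] show "(\<lambda>k. ?q k l) \<longlonglongrightarrow> total_influence l (root_rule l) x0"
        by (simp add: minus_divide_left[symmetric] divide_minus_right[symmetric]
            minus_divide_right diff_divide_distrib)
    qed
    show "AE l in measure_pmf chi. norm (?q k l) \<le> real l" for k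
    proof (rule AE_I2)
      fix l
      have "0 \<le> ?q k l" using e[of k]
          noise_stability_mono[of "label_var - e k" label_var l "root_rule l" x0] by simp
      moreover have "?q k l \<le> total_influence l (root_rule l) x0"
        using noise_stability_convex(1)[OF boolean_monotone_threshold, of "label_var - e k" x0 l "h l"]
            e[of k] by (simp add: field_simps)
      ultimately show "norm (?q k l) \<le> real l"
        using total_influence_bounds(2)[OF boolean_monotone_threshold x01, of l "h l"] by simp
    qed
  qed auto
  then have "(\<lambda>k. (cov_map label_var - cov_map (label_var - e k)) / e k) \<longlonglongrightarrow> expected_influence"
    using e label_var_pos by (simp add: expected_influence_def cov_map_def integrable_noise_stability
        less_imp_le)
  then have "eventually (\<lambda>k. 1 < (cov_map label_var - cov_map (label_var - e k)) / e k) sequentially"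
    using \<open>\<not> expected_influence \<le> 1\<close> by (intro order_tendstoD) auto
  then obtain k where "1 < (cov_map label_var - cov_map (label_var - e k)) / e k"
    by (auto simp: eventually_sequentially)
  then have k: "cov_map (label_var - e k) < label_var - e k" using e[of k] cov_map_label_var
    by (simp add: field_simps)
  have "cov n \<le> label_var - e k" for n
  proof (induction n)
    case 0 then show ?case using e[of k] by (simp add: cov_0)
  next
    case (Suc n)
    then have "cov_map (cov n) \<le> cov_map (label_var - e k)" using cov_bounds e[of k]
      by (intro cov_map_mono) auto
    then show ?case using k by (simp add: cov_Suc)
  qed
  then have "label_var \<le> label_var - e k" by (intro LIMSEQ_le_const2[OF assms]) auto
  then show False using e[of k] by simp
qed

end

section \<open>Resampling the offspring numbers of late generations\<close>

text \<open>
  The event that membership in \<open>A\<close> changes when all generations from \<open>n\<close> on are replaced by an independent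
  copy.
\<close>

definition unstable :: "nat \<Rightarrow> (nat list \<Rightarrow> nat) set \<Rightarrow> ((nat list \<Rightarrow> nat) \<times> (nat list \<Rightarrow> nat)) set" where
  "unstable n A = {p. fst p \<in> A \<longleftrightarrow> graft n (fst p) (snd p) \<notin> A}"

lemma sets_unstable [measurable]:
  assumes [measurable]: "A \<in> sets (offspring chi)"
  shows "unstable n A \<in> sets (offspring chi \<Otimes>\<^sub>M offspring chi)"
proof -
  have "{p \<in> space (offspring chi \<Otimes>\<^sub>M offspring chi). fst p \<in> A \<longleftrightarrow> graft n (fst p) (snd p) \<notin> A} \<in> sets
      (offspring chi \<Otimes>\<^sub>M offspring chi)"
    by measurable
  then show ?thesis by (simp add: unstable_def space_pair_measure)
qed

lemma measure_fst_graft: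
  assumes [measurable]: "A \<in> sets (offspring chi)"
  shows "measure (offspring chi \<Otimes>\<^sub>M offspring chi) {p. fst p \<in> A} = measure (offspring chi) A"
    and "measure (offspring chi \<Otimes>\<^sub>M offspring chi) {p. graft n (fst p) (snd p) \<in> A} = measure (offspring chi) A"
    and "{p. fst p \<in> A} \<in> sets (offspring chi \<Otimes>\<^sub>M offspring chi)"
    and "{p. graft n (fst p) (snd p) \<in> A} \<in> sets (offspring chi \<Otimes>\<^sub>M offspring chi)"
proof -
  interpret prob_space "offspring chi" by (rule prob_space_offspring)
  interpret PP: pair_prob_space "offspring chi" "offspring chi" ..
  have "{p. fst p \<in> A} = A \<times> space (offspring chi)" by auto
  then show "measure (offspring chi \<Otimes>\<^sub>M offspring chi) {p. fst p \<in> A} = measure (offspring chi) A"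
    "{p. fst p \<in> A} \<in> sets (offspring chi \<Otimes>\<^sub>M offspring chi)"
    using emeasure_pair_measure_Times[OF assms sets.top[of "offspring chi"]] emeasure_space_1
      pair_measureI[OF assms sets.top[of "offspring chi"]]
    by (simp_all add: measure_def)
  have *: "{p. graft n (fst p) (snd p) \<in> A} =
      (\<lambda>p. graft n (fst p) (snd p)) -` A \<inter> space (offspring chi \<Otimes>\<^sub>M offspring chi)"
    by (auto simp: space_pair_measure)
  show "measure (offspring chi \<Otimes>\<^sub>M offspring chi) {p. graft n (fst p) (snd p) \<in> A} = measure (offspring chi) A"
    unfolding * by (subst measure_distr[OF measurable_graft assms, symmetric]) (simp add: distr_graft)
  show "{p. graft n (fst p) (snd p) \<in> A} \<in> sets (offspring chi \<Otimes>\<^sub>M offspring chi)"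
    unfolding * by measurable
qed

text \<open>
  Cylinder sets are not affected once \<open>n\<close> exceeds their depth, and the events with this property form a
  \<open>\<sigma>\<close>-algebra: a countable union is approximated by a finite one, and replacing one by the other changes the
  indicator with small probability both before and after resampling.
\<close>

lemma unstable_tendsto_0:
  assumes "A \<in> sets (offspring chi)"
  shows "(\<lambda>n. measure (offspring chi \<Otimes>\<^sub>M offspring chi) (unstable n A)) \<longlonglongrightarrow> 0"
proof -
  interpret prob_space "offspring chi" by (rule prob_space_offspring)
  interpret PP: pair_prob_space "offspring chi" "offspring chi" ..
  let ?P = "measure (offspring chi \<Otimes>\<^sub>M offspring chi)"
  have sets: "sets (offspring chi) = sigma_sets UNIV {{N. N v \<in> E} | v E. True}"
    using sets_PiM_single[of "UNIV :: nat list set" "\<lambda>_. measure_pmf chi"] by (simp add: PiE_UNIV_domain)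
  from assms show ?thesis unfolding sets
  proof (induction rule: sigma_sets.induct)
    case (Basic A)
    then obtain v E where A: "A = {N. N v \<in> E}" by auto
    have "unstable n A = {}" if "n > length v" for n
      using that by (auto simp: unstable_def A graft_def)
    then have "\<forall>\<^sub>F n in sequentially. ?P (unstable n A) = 0"
      by (intro eventually_mono[OF eventually_gt_at_top[of "length v"]]) simp
    then show ?case by (rule tendsto_eventually)
  next
    case Empty
    show ?case by (simp add: unstable_def)
  next
    case (Compl A)
    have "unstable n (UNIV - A) = unstable n A" for n by (auto simp: unstable_def)
    then show ?case using Compl.IH by simp
  next
    case (Union A)
    have [measurable]: "A i \<in> sets (offspring chi)" for i using Union.hyps sets by auto
    define B where "B k = (\<Union>i<k. A i)" for k
    have [measurable]: "B k \<in> sets (offspring chi)" for k unfolding B_def by auto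
    let ?U = "\<Union>i. A i"
    have "(\<lambda>k. measure (offspring chi) (B k)) \<longlonglongrightarrow> measure (offspring chi) (\<Union>k. B k)"
      by (rule finite_Lim_measure_incseq) (auto simp: B_def incseq_def intro: order_less_le_trans)
    moreover have "(\<Union>k. B k) = ?U" by (auto simp: B_def)
    ultimately have lim: "(\<lambda>k. measure (offspring chi) ?U - measure (offspring chi) (B k)) \<longlonglongrightarrow> 0"
      using tendsto_diff[OF tendsto_const, of "\<lambda>k. measure (offspring chi) (B k)"
          "measure (offspring chi) ?U" sequentially "measure (offspring chi) ?U"] by simp
    have diff: "measure (offspring chi) (?U - B k) =
        measure (offspring chi) ?U - measure (offspring chi) (B k)" for k
      by (rule finite_measure_Diff) (auto simp: B_def)
    show ?case
    proof (rule LIMSEQ_I)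
      fix e :: real assume e: "0 < e"
      obtain k where k: "measure (offspring chi) (?U - B k) < e / 4"
        using order_tendstoD(2)[OF lim, of "e / 4"] e unfolding diff by (auto simp: eventually_sequentially)
      have "(\<lambda>n. \<Sum>i<k. ?P (unstable n (A i))) \<longlonglongrightarrow> (\<Sum>i<k. 0)"
        by (intro tendsto_sum Union.IH)
      then obtain n0 where n0: "\<And>n. n \<ge> n0 \<Longrightarrow> (\<Sum>i<k. ?P (unstable n (A i))) < e / 4"
        using order_tendstoD(2)[of _ 0 sequentially "e / 4"] e by (auto simp: eventually_sequentially)
      have "norm (?P (unstable n ?U) - 0) < e" if "n \<ge> n0" for n
      proof -
        let ?R = "?U - B k"
        have R: "?R \<in> sets (offspring chi)" by measurable
        note m = measure_fst_graft(1,3)[OF R] measure_fst_graft(2,4)[OF R, of n]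
        have "?P (unstable n ?U) \<le> ?P (((\<Union>i<k. unstable n (A i)) \<union> {p. fst p \<in> ?R}) \<union>
            {p. graft n (fst p) (snd p) \<in> ?R})"
          by (intro PP.P.finite_measure_mono sets.Un sets.finite_UN m sets_unstable)
              (auto simp: unstable_def B_def)
        also have "\<dots> \<le> ?P ((\<Union>i<k. unstable n (A i)) \<union> {p. fst p \<in> ?R}) + ?P {p. graft n (fst p) (snd p) \<in> ?R}"
          by (intro measure_Un_le sets.Un sets.finite_UN m sets_unstable) auto
        also have "\<dots> \<le> ?P (\<Union>i<k. unstable n (A i)) + ?P {p. fst p \<in> ?R} + ?P {p. graft n (fst p) (snd p) \<in> ?R}"
          by (intro add_right_mono measure_Un_le sets.Un sets.finite_UN m sets_unstable) auto
        also have "\<dots> \<le> (\<Sum>i<k. ?P (unstable n (A i))) + ?P {p. fst p \<in> ?R} + ?P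
            {p. graft n (fst p) (snd p) \<in> ?R}"
          by (intro add_right_mono measure_UNION_le) auto
        also have "\<dots> < e" using n0[OF that] k e unfolding m by simp
        finally show ?thesis by simp
      qed
      then show "\<exists>n0. \<forall>n\<ge>n0. norm (?P (unstable n ?U) - 0) < e" by blast
    qed
  qed
qed

lemma AE_below:
  assumes "AE N in offspring chi. P N"
  shows "AE N in offspring chi. \<forall>i. P (below i N)"
  unfolding AE_all_countable
proof
  fix i
  have "AE N in distr (offspring chi) (offspring chi) (below i). P N"
    using assms by (simp only: distr_below)
  from AE_distrD[OF measurable_below this] show "AE N in offspring chi. P (below i N)" .
qed

lemma unit_valued_graft: "unit_valued chi Y \<Longrightarrow> unit_valued chi (\<lambda>N'. Y (graft n N N'))"
proof -
  assume Y: "unit_valued chi Y"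
  then have [measurable]: "Y \<in> borel_measurable (offspring chi)" by (simp add: unit_valued_def)
  have "(\<lambda>N'. (\<lambda>p. graft n (fst p) (snd p)) (N, N')) \<in> offspring chi \<rightarrow>\<^sub>M offspring chi"
    by (rule measurable_compose[OF _ measurable_graft]) simp
  then have "(\<lambda>N'. graft n N N') \<in> offspring chi \<rightarrow>\<^sub>M offspring chi" by simp
  from measurable_compose[OF this, of Y borel] show ?thesis using Y by (simp add: unit_valued_def)
qed

lemma step_cong: "(\<And>i. Y (below i N) = Z (below i N)) \<Longrightarrow> step h Y N = step h Z N"
  by (simp add: step_def)

lemma tendsto_step:
  assumes "\<And>i. (\<lambda>k. Y k (below i N)) \<longlonglongrightarrow> Z (below i N)"
  shows "(\<lambda>k. step h (Y k) N) \<longlonglongrightarrow> step h Z N"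
proof -
  have "(\<lambda>k. if i \<in> A then Y k (below i N) else 1 - Y k (below i N)) \<longlonglongrightarrow>
      (if i \<in> A then Z (below i N) else 1 - Z (below i N))" for i A
    by (cases "i \<in> A") (auto intro!: tendsto_intros assms)
  then show ?thesis unfolding step_def multilinear_def by (intro tendsto_intros)
qed

lemma integral_sq_diff:
  assumes "unit_valued chi Y" "unit_valued chi Z"
  shows "(\<integral>N. (Y N - Z N)\<^sup>2 \<partial>offspring chi) =
      (\<integral>N. Y N * Y N \<partial>offspring chi) + (\<integral>N. Z N * Z N \<partial>offspring chi) - 2 * (\<integral>N. Y N * Z N \<partial>offspring chi)"
    and "integrable (offspring chi) (\<lambda>N. (Y N - Z N)\<^sup>2)"
proof -
  note i = unit_valued_integrable[OF unit_valued_mult[OF assms(1) assms(1)]]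
      unit_valued_integrable[OF unit_valued_mult[OF assms(2) assms(2)]]
     unit_valued_integrable[OF unit_valued_mult[OF assms]]
  have *: "(Y N - Z N)\<^sup>2 = Y N * Y N + Z N * Z N - 2 * (Y N * Z N)" for N
    by (simp add: power2_eq_square algebra_simps)
  show "(\<integral>N. (Y N - Z N)\<^sup>2 \<partial>offspring chi) =
      (\<integral>N. Y N * Y N \<partial>offspring chi) + (\<integral>N. Z N * Z N \<partial>offspring chi) - 2 * (\<integral>N. Y N * Z N \<partial>offspring chi)"
    unfolding * using i by simp
  show "integrable (offspring chi) (\<lambda>N. (Y N - Z N)\<^sup>2)"
    unfolding * using i by simp
qed

lemma sq_diff_0_AE:
  assumes "unit_valued chi Y" "unit_valued chi Z" "(\<integral>N. (Y N - Z N)\<^sup>2 \<partial>offspring chi) = 0"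
  shows "AE N in offspring chi. Y N = Z N"
  using assms(3) integral_sq_diff(2)[OF assms(1,2)]
  by (subst (asm) integral_nonneg_eq_0_iff_AE) auto

section \<open>Solutions of the recursion\<close>

context fixed_point
begin

text \<open>
  The conditional probability that the root has label 1 given the first \<open>n\<close> generations, if the vertices of
  generation \<open>n\<close> have independent Bernoulli labels with parameter \<open>x0\<close>.
\<close>

definition posterior :: "nat \<Rightarrow> (nat list \<Rightarrow> nat) \<Rightarrow> real" where
  "posterior n = (step h ^^ n) (\<lambda>_. x0)"

lemma posterior_0: "posterior 0 = (\<lambda>_. x0)" and posterior_Suc: "posterior (Suc n) = step h (posterior n)"
  by (simp_all add: posterior_def)

lemma unit_valued_posterior: "unit_valued chi (posterior n)"
proof (induction n)
  case 0 then show ?case using x0_pos x0_less by (simp add: posterior_0 unit_valued_def)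
qed (simp add: posterior_Suc unit_valued_step)

lemma mean_step: "unit_valued chi Y \<Longrightarrow> (\<integral>N. Y N \<partial>offspring chi) = x0 \<Longrightarrow> (\<integral>N. step h Y N \<partial>offspring chi) = x0"
  by (simp add: integral_step integral_multilinear_x0)

lemma integral_const_offspring: "(\<integral>N. c \<partial>offspring chi) = (c :: real)"
  using prob_space.prob_space[OF prob_space_offspring[of chi]] by simp

lemma mean_posterior: "(\<integral>N. posterior n N \<partial>offspring chi) = x0"
proof (induction n)
  case 0 show ?case unfolding posterior_0 by (rule integral_const_offspring)
qed (simp add: posterior_Suc mean_step unit_valued_posterior)

lemma corr_step:
  assumes "unit_valued chi Y" "(\<integral>N. Y N \<partial>offspring chi) = x0" "unit_valued chi Z"
      "(\<integral>N. Z N \<partial>offspring chi) = x0"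
  shows "(\<integral>N. step h Y N * step h Z N \<partial>offspring chi) = x0\<^sup>2 + cov_map ((\<integral>N. Y N * Z N \<partial>offspring chi) - x0\<^sup>2)"
  by (simp add: integral_step_mult[OF assms] cov_map_def)

lemma corr_posterior: "(\<integral>N. posterior n N * posterior m N \<partial>offspring chi) = x0\<^sup>2 + cov (min n m)"
proof (induction n arbitrary: m)
  case 0
  show ?case by (simp add: posterior_0 cov_0 mean_posterior power2_eq_square)
next
  case (Suc n)
  show ?case
  proof (cases m)
    case 0
    then show ?thesis using mean_posterior[of "Suc n"] by (simp add: posterior_0 cov_0 power2_eq_square)
  next
    case (Suc k)
    then show ?thesis
      by (simp add: posterior_Suc corr_step unit_valued_posterior mean_posterior Suc.IH cov_Suc)
  qed
qed

text \<open>
  The properties of the indicator of an interpretation associated with \<open>x0\<close>, read as a function of the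
  offspring numbers.
\<close>

definition solution :: "((nat list \<Rightarrow> nat) \<Rightarrow> real) \<Rightarrow> bool" where
  "solution X \<longleftrightarrow> X \<in> borel_measurable (offspring chi) \<and> (\<forall>N. X N = 0 \<or> X N = 1) \<and>
     (\<integral>N. X N \<partial>offspring chi) = x0 \<and> (AE N in offspring chi. X N = step h X N)"

lemma unit_valued_solution: "solution X \<Longrightarrow> unit_valued chi X"
  unfolding solution_def unit_valued_def by (metis order_refl zero_le_one)

lemma solution_sq: "solution X \<Longrightarrow> X N * X N = X N"
  unfolding solution_def by (metis mult_1 mult_zero_left)

lemma corr_solution:
  assumes X: "solution X"
  shows "(\<integral>N. X N * posterior n N \<partial>offspring chi) = x0\<^sup>2 + cov n"
proof (induction n)
  case 0
  then show ?case using X by (simp add: posterior_0 cov_0 solution_def power2_eq_square)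
next
  case (Suc n)
  have m: "(\<integral>N. X N \<partial>offspring chi) = x0" "AE N in offspring chi. X N = step h X N"
    using X by (auto simp: solution_def)
  have [measurable]: "X \<in> borel_measurable (offspring chi)" "step h X \<in> borel_measurable (offspring chi)"
      "posterior (Suc n) \<in> borel_measurable (offspring chi)"
    using unit_valued_solution[OF X] unit_valued_posterior[of "Suc n"] unit_valued_step[of chi X h]
      by (auto simp: unit_valued_def)
  have "(\<integral>N. X N * posterior (Suc n) N \<partial>offspring chi) =
      (\<integral>N. step h X N * step h (posterior n) N \<partial>offspring chi)"
    unfolding posterior_Suc[symmetric] using m(2) by (intro integral_cong_AE) auto
  also have "\<dots> = x0\<^sup>2 + cov (Suc n)"
    using corr_step[OF unit_valued_solution[OF X] m(1) unit_valued_posterior mean_posterior] Suc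
      by (simp add: cov_Suc)
  finally show ?case .
qed

lemma dist_solution:
  assumes X: "solution X"
  shows "(\<integral>N. (X N - posterior n N)\<^sup>2 \<partial>offspring chi) = label_var - cov n"
  unfolding integral_sq_diff(1)[OF unit_valued_solution[OF X] unit_valued_posterior] corr_posterior
      corr_solution[OF X] solution_sq[OF X]
  using X by (simp add: solution_def algebra_simps power2_eq_square)

text \<open>
  Every solution has \<open>posterior n\<close> as its conditional expectation given the first \<open>n\<close> generations: conditionally
  on them, the labels of distinct children are independent, and \<open>step\<close> is multilinear in these labels.
\<close>

lemma solution_graft:
  assumes X: "solution X"
  shows "AE N in offspring chi. (\<integral>N'. X (graft n N N') \<partial>offspring chi) = posterior n N"
proof (induction n)
  case 0
  have "graft 0 N N' = N'" for N N' by (simp add: fun_eq_iff graft_def)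
  then show ?case using X by (simp add: posterior_0 solution_def)
next
  case (Suc n)
  interpret prob_space "offspring chi" by (rule prob_space_offspring)
  interpret PP: pair_prob_space "offspring chi" "offspring chi" ..
  have r: "unit_valued chi X" by (rule unit_valued_solution[OF X])
  have "AE N in distr (offspring chi \<Otimes>\<^sub>M offspring chi) (offspring chi) (\<lambda>p. graft (Suc n) (fst p) (snd p)).
      X N = step h X N"
    using X by (simp only: solution_def distr_graft)
  from AE_distrD[OF measurable_graft this]
  have "AE p in offspring chi \<Otimes>\<^sub>M offspring chi. X (graft (Suc n) (fst p) (snd p)) =
      step h X (graft (Suc n) (fst p) (snd p))" .
  from PP.AE_pair[OF this]
  have *: "AE N in offspring chi. AE N' in offspring chi. X (graft (Suc n) N N') =
      step h X (graft (Suc n) N N')"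
    by simp
  from * AE_below[OF Suc.IH] show ?case
  proof eventually_elim
    case (elim N)
    have "(\<integral>N'. X (graft (Suc n) N N') \<partial>offspring chi) = (\<integral>N'. step h X (graft (Suc n) N N') \<partial>offspring chi)"
      using elim(1) unit_valued_graft[OF r] unit_valued_graft[OF unit_valued_step[OF r]]
      by (intro integral_cong_AE) (auto simp: unit_valued_def)
    also have "\<dots> = (\<integral>N'. multilinear (N []) (root_rule (N [])) (\<lambda>i. X (graft n (below i N) (below i N')))
        \<partial>offspring chi)"
      by (simp only: step_def below_graft_Suc graft_Suc_root)
    also have "\<dots> = multilinear (N []) (root_rule (N [])) (\<lambda>i. \<integral>N'. X (graft n (below i N) N') \<partial>offspring chi)"
      by (rule integral_multilinear_below) (rule unit_valued_graft[OF r])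
    also have "\<dots> = posterior (Suc n) N"
      using elim(2) by (simp add: posterior_Suc step_def)
    finally show ?case .
  qed
qed

text \<open>
  Two labels with values in \<open>{0, 1}\<close> differ with probability \<open>E[X] + E[X'] - 2 * E[X * X']\<close>, and by
  \<open>solution_graft\<close> the last expectation is that of \<open>X * posterior n\<close>.
\<close>

lemma solution_unstable:
  assumes X: "solution X"
  shows "measure (offspring chi \<Otimes>\<^sub>M offspring chi) (unstable n {N. X N = 1}) = 2 * (label_var - cov n)"
proof -
  interpret prob_space "offspring chi" by (rule prob_space_offspring)
  interpret PP: pair_prob_space "offspring chi" "offspring chi" ..
  have [measurable]: "X \<in> borel_measurable (offspring chi)" using X by (simp add: solution_def)
  have r: "unit_valued chi X" by (rule unit_valued_solution[OF X])
  have X01: "X N = 0 \<or> X N = 1" for N using X by (simp add: solution_def)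
  let ?G = "\<lambda>p. X (graft n (fst p) (snd p))"
  have "{N \<in> space (offspring chi). X N = 1} \<in> sets (offspring chi)" by measurable
  then have U: "unstable n {N. X N = 1} \<in> sets (offspring chi \<Otimes>\<^sub>M offspring chi)" by (intro sets_unstable) simp
  have i1: "integrable (offspring chi \<Otimes>\<^sub>M offspring chi) ?G" by (rule integral_graft(2)[OF r])
  have i2: "integrable (offspring chi \<Otimes>\<^sub>M offspring chi) (\<lambda>p. X (fst p))"
    "integrable (offspring chi \<Otimes>\<^sub>M offspring chi) (\<lambda>p. X (fst p) * ?G p)"
    using r by (auto intro!: PP.P.integrable_const_bound[of _ 1] simp: unit_valued_def abs_of_nonneg
        mult_le_one)
  have "measure (offspring chi \<Otimes>\<^sub>M offspring chi) (unstable n {N. X N = 1}) =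
      (\<integral>p. indicator (unstable n {N. X N = 1}) p \<partial>(offspring chi \<Otimes>\<^sub>M offspring chi))"
    using U by simp
  also have "\<dots> = (\<integral>p. X (fst p) + ?G p - 2 * (X (fst p) * ?G p) \<partial>(offspring chi \<Otimes>\<^sub>M offspring chi))"
  proof (intro Bochner_Integration.integral_cong refl)
    fix p show "indicator (unstable n {N. X N = 1}) p = X (fst p) + ?G p - 2 * (X (fst p) * ?G p)"
      using X01[of "fst p"] X01[of "graft n (fst p) (snd p)"]
      by (auto simp: indicator_def unstable_def)
  qed
  also have "\<dots> = (\<integral>p. X (fst p) \<partial>(offspring chi \<Otimes>\<^sub>M offspring chi)) +
      (\<integral>p. ?G p \<partial>(offspring chi \<Otimes>\<^sub>M offspring chi)) -
      2 * (\<integral>p. X (fst p) * ?G p \<partial>(offspring chi \<Otimes>\<^sub>M offspring chi))"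
    using i1 i2 by simp
  also have "(\<integral>p. X (fst p) \<partial>(offspring chi \<Otimes>\<^sub>M offspring chi)) = x0"
    using PP.integral_fst'[OF i2(1)] X by (simp add: solution_def prob_space[simplified])
  also have "(\<integral>p. ?G p \<partial>(offspring chi \<Otimes>\<^sub>M offspring chi)) = x0"
    using PP.integral_fst'[OF i1] integral_graft(1)[OF r, of n] X by (simp add: solution_def)
  also have "(\<integral>p. X (fst p) * ?G p \<partial>(offspring chi \<Otimes>\<^sub>M offspring chi)) =
      (\<integral>N. X N * posterior n N \<partial>offspring chi)"
  proof -
    have "(\<integral>p. X (fst p) * ?G p \<partial>(offspring chi \<Otimes>\<^sub>M offspring chi)) =
        (\<integral>N. X N * (\<integral>N'. X (graft n N N') \<partial>offspring chi) \<partial>offspring chi)"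
      using PP.integral_fst'[OF i2(2)] by simp
    also have "\<dots> = (\<integral>N. X N * posterior n N \<partial>offspring chi)"
    proof (rule integral_cong_AE)
      show "(\<lambda>N. X N * (\<integral>N'. X (graft n N N') \<partial>offspring chi)) \<in> borel_measurable (offspring chi)"
        using borel_measurable_integrable[OF PP.integrable_fst'[OF i2(2)]] by simp
      show "(\<lambda>N. X N * posterior n N) \<in> borel_measurable (offspring chi)"
        using unit_valued_posterior[of n] by (intro borel_measurable_times) (simp_all add: unit_valued_def)
      show "AE N in offspring chi. X N * (\<integral>N'. X (graft n N N') \<partial>offspring chi) = X N * posterior n N"
        using solution_graft[OF X, of n] by eventually_elim simp
    qed
    finally show ?thesis .
  qed
  finally show ?thesis by (simp add: corr_solution[OF X] algebra_simps power2_eq_square)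
qed

lemma solution_imp_tendsto:
  assumes X: "solution X" shows "cov \<longlonglongrightarrow> label_var"
proof -
  have [measurable]: "X \<in> borel_measurable (offspring chi)" using X by (simp add: solution_def)
  have "{N \<in> space (offspring chi). X N = 1} \<in> sets (offspring chi)" by measurable
  then have "(\<lambda>n. 2 * (label_var - cov n)) \<longlonglongrightarrow> 0"
    using unstable_tendsto_0[of "{N. X N = 1}" chi] by (simp add: solution_unstable[OF X])
  from tendsto_diff[OF tendsto_const[of label_var] tendsto_mult_right[OF this, of "1/2"]]
  have "(\<lambda>n. label_var - 2 * (label_var - cov n) * (1 / 2)) \<longlonglongrightarrow> label_var" by simp
  moreover have "label_var - 2 * (label_var - cov n) * (1 / 2) = cov n" for n by (simp add: field_simps)
  ultimately show ?thesis by simp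
qed

lemma solution_unique:
  assumes X: "solution X" and Y: "solution Y"
  shows "AE N in offspring chi. X N = Y N"
proof (rule sq_diff_0_AE)
  show r: "unit_valued chi X" "unit_valued chi Y" using X Y by (auto intro: unit_valued_solution)
  have "(\<integral>N. (X N - Y N)\<^sup>2 \<partial>offspring chi) \<le> 4 * (label_var - cov n)" for n
  proof -
    note i = integral_sq_diff(2)[OF r(1) unit_valued_posterior[of n]]
        integral_sq_diff(2)[OF r(2) unit_valued_posterior[of n]]
    have "(X N - Y N)\<^sup>2 \<le> 2 * (X N - posterior n N)\<^sup>2 + 2 * (Y N - posterior n N)\<^sup>2" for N
      using zero_le_power2[of "(X N - posterior n N) + (Y N - posterior n N)"]
        by (simp add: power2_eq_square algebra_simps)
    then have "(\<integral>N. (X N - Y N)\<^sup>2 \<partial>offspring chi) \<le>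
        (\<integral>N. 2 * (X N - posterior n N)\<^sup>2 + 2 * (Y N - posterior n N)\<^sup>2 \<partial>offspring chi)"
      using i integral_sq_diff(2)[OF r] by (intro integral_mono) auto
    also have "\<dots> = 4 * (label_var - cov n)"
      using i by (simp add: dist_solution X Y)
    finally show ?thesis .
  qed
  moreover have "(\<lambda>n. 4 * (label_var - cov n)) \<longlonglongrightarrow> 4 * (label_var - label_var)"
    by (intro tendsto_intros solution_imp_tendsto[OF X])
  ultimately have "(\<integral>N. (X N - Y N)\<^sup>2 \<partial>offspring chi) \<le> 4 * (label_var - label_var)"
    by (intro LIMSEQ_le_const) auto
  then show "(\<integral>N. (X N - Y N)\<^sup>2 \<partial>offspring chi) = 0"
    using Bochner_Integration.integral_nonneg[of "offspring chi" "\<lambda>N. (X N - Y N)\<^sup>2"] by (intro antisym) auto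
qed

lemma posterior_L1_Cauchy:
  assumes "cov \<longlonglongrightarrow> label_var" "0 < e"
  shows "\<exists>n0. \<forall>i\<ge>n0. \<forall>j\<ge>n0. (\<integral>N. norm (posterior i N - posterior j N) \<partial>offspring chi) < e"
proof -
  obtain n0 where n0: "\<And>i j. i \<ge> n0 \<Longrightarrow> j \<ge> n0 \<Longrightarrow> \<bar>cov i - cov j\<bar> < e\<^sup>2 / 4"
    using CauchyD[OF LIMSEQ_imp_Cauchy[OF assms(1)], of "e\<^sup>2 / 4"] assms(2) by auto
  have "(\<integral>N. norm (posterior i N - posterior j N) \<partial>offspring chi) < e" if "i \<ge> n0" "j \<ge> n0" for i j
  proof -
    note sq = integral_sq_diff[OF unit_valued_posterior[of i] unit_valued_posterior[of j]]
    interpret prob_space "offspring chi" by (rule prob_space_offspring)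
    have "(\<integral>N. (posterior i N - posterior j N)\<^sup>2 \<partial>offspring chi) = \<bar>cov i - cov j\<bar>"
      unfolding sq(1) corr_posterior using incseqD[OF incseq_cov, of i j] incseqD[OF incseq_cov, of j i]
      by (cases "i \<le> j") (auto simp: min_def)
    then have d: "(\<integral>N. (posterior i N - posterior j N)\<^sup>2 \<partial>offspring chi) < e\<^sup>2 / 4" using n0[OF that] by simp
    \<comment> \<open>passes from \<open>L\<^sup>2\<close> to \<open>L\<^sup>1\<close>\<close>
    have "norm a \<le> 2 / e * a\<^sup>2 + e / 2" for a :: real
    proof (cases "\<bar>a\<bar> \<le> e / 2")
      case True then show ?thesis using assms(2) by (simp add: add_increasing)
    next
      case False
      then have "\<bar>a\<bar> * (e / 2) \<le> \<bar>a\<bar> * \<bar>a\<bar>" by (intro mult_left_mono) auto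
      then have "\<bar>a\<bar> \<le> 2 / e * a\<^sup>2" using assms(2) by (simp add: field_simps power2_eq_square)
      then show ?thesis using assms(2) by simp
    qed
    then have "(\<integral>N. norm (posterior i N - posterior j N) \<partial>offspring chi) \<le>
        (\<integral>N. 2 / e * (posterior i N - posterior j N)\<^sup>2 + e / 2 \<partial>offspring chi)"
      using sq(2) unit_valued_integrable[OF unit_valued_posterior] by (intro integral_mono) auto
    also have "\<dots> = 2 / e * (\<integral>N. (posterior i N - posterior j N)\<^sup>2 \<partial>offspring chi) + e / 2"
      using sq(2) by (simp add: prob_space[simplified])
    also have "\<dots> < 2 / e * (e\<^sup>2 / 4) + e / 2"
      using d assms(2) by (intro add_strict_right_mono mult_strict_left_mono) auto
    also have "\<dots> = e" using assms(2) by (simp add: power2_eq_square)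
    finally show ?thesis .
  qed
  then show ?thesis by blast
qed

text \<open>
  Let \<open>Y\<close> be an almost sure limit of \<open>posterior (r i)\<close>. Its second moment \<open>x0\<close> equals its mean, so \<open>Y\<close> takes
  values in \<open>{0, 1}\<close>. Its image \<open>step h Y\<close> is the limit of \<open>posterior (Suc (r i))\<close>, and \<open>corr_posterior\<close> shows
  that the second moments of \<open>Y\<close> and \<open>step h Y\<close> and their mixed moment all equal \<open>x0\<close>, so they agree. The limit
  is given by an explicit formula since \<open>solution_interpretation\<close> applies only to functions of the tree.
\<close>

lemma solution_exists:
  assumes "cov \<longlonglongrightarrow> label_var"
  obtains r where "solution (\<lambda>N. of_bool (lim (\<lambda>i. posterior (r i) N) = 1))"
proof -
  obtain r where r: "strict_mono r" and C: "AE N in offspring chi. Cauchy (\<lambda>i. posterior (r i) N)"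
    by (rule cauchy_L1_AE_cauchy_subseq[of "offspring chi" posterior])
        (use posterior_L1_Cauchy[OF assms] in \<open>auto intro: unit_valued_integrable unit_valued_posterior\<close>)
  define Z where "Z N = lim (\<lambda>i. posterior (r i) N)" for N
  \<comment> \<open>truncation gives values in \<open>[0, 1]\<close> also where the sequence diverges\<close>
  define Y where "Y N = max 0 (min 1 (Z N))" for N
  define X :: "(nat list \<Rightarrow> nat) \<Rightarrow> real" where "X N = of_bool (Z N = 1)" for N
  have [measurable]: "posterior n \<in> borel_measurable (offspring chi)" for n using unit_valued_posterior
    by (simp add: unit_valued_def)
  have M01: "0 \<le> posterior n N" "posterior n N \<le> 1" for n N using unit_valued_posterior
    by (auto simp: unit_valued_def)
  have [measurable]: "Z \<in> borel_measurable (offspring chi)" unfolding Z_def by measurable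
  have rY: "unit_valued chi Y" unfolding unit_valued_def Y_def by (auto, measurable)
  then have [measurable]: "Y \<in> borel_measurable (offspring chi)" by (simp add: unit_valued_def)
  have lim: "AE N in offspring chi. (\<lambda>i. posterior (r i) N) \<longlonglongrightarrow> Z N \<and> Y N = Z N"
    using C
  proof eventually_elim
    case (elim N)
    then have l: "(\<lambda>i. posterior (r i) N) \<longlonglongrightarrow> Z N"
      unfolding Z_def by (simp add: Cauchy_convergent_iff convergent_LIMSEQ_iff)
    then have "0 \<le> Z N" "Z N \<le> 1" using LIMSEQ_le_const[OF l] LIMSEQ_le_const2[OF l] M01 by blast+
    then show ?case using l by (simp add: Y_def)
  qed
  have limY: "AE N in offspring chi. (\<lambda>i. posterior (r i) N) \<longlonglongrightarrow> Y N" using lim by eventually_elim auto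
  have sr: "(\<lambda>i. x0\<^sup>2 + cov (r i)) \<longlonglongrightarrow> x0"
    using tendsto_add[OF tendsto_const[of "x0\<^sup>2"] LIMSEQ_subseq_LIMSEQ[OF assms r, unfolded comp_def]]
    by (simp add: power2_eq_square algebra_simps)
  interpret prob_space "offspring chi" by (rule prob_space_offspring)
  have "(\<lambda>i. \<integral>N. posterior (r i) N \<partial>offspring chi) \<longlonglongrightarrow> (\<integral>N. Y N \<partial>offspring chi)"
    using limY M01 by (intro integral_dominated_convergence[where w="\<lambda>_. 1"]) auto
  then have meanY: "(\<integral>N. Y N \<partial>offspring chi) = x0" by (simp add: mean_posterior LIMSEQ_const_iff)
  have "(\<lambda>i. \<integral>N. posterior (r i) N * posterior (r i) N \<partial>offspring chi) \<longlonglongrightarrow> (\<integral>N. Y N * Y N \<partial>offspring chi)"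
    using limY M01 by (intro integral_dominated_convergence[where w="\<lambda>_. 1"])
        (auto intro!: tendsto_mult simp: abs_mult mult_le_one)
  then have sqY: "(\<integral>N. Y N * Y N \<partial>offspring chi) = x0"
    using LIMSEQ_unique[OF _ sr] by (simp add: corr_posterior)
  have rS: "unit_valued chi (step h Y)" by (rule unit_valued_step[OF rY])
  then have [measurable]: "step h Y \<in> borel_measurable (offspring chi)" by (simp add: unit_valued_def)
  have limS: "AE N in offspring chi. (\<lambda>i. posterior (Suc (r i)) N) \<longlonglongrightarrow> step h Y N"
    using AE_below[OF limY] by eventually_elim (auto simp: posterior_Suc intro!: tendsto_step)
  have "(\<lambda>i. \<integral>N. posterior (r i) N * posterior (Suc (r i)) N \<partial>offspring chi) \<longlonglongrightarrow>
      (\<integral>N. Y N * step h Y N \<partial>offspring chi)"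
  proof (intro integral_dominated_convergence[where w="\<lambda>_. 1"])
    show "AE N in offspring chi. (\<lambda>i. posterior (r i) N * posterior (Suc (r i)) N) \<longlonglongrightarrow> Y N * step h Y N"
      using limY limS by eventually_elim (rule tendsto_mult)
  qed (use M01 in \<open>auto simp: abs_mult mult_le_one\<close>)
  then have crossY: "(\<integral>N. Y N * step h Y N \<partial>offspring chi) = x0"
    using LIMSEQ_unique[OF _ sr] by (simp add: corr_posterior min_def)
  have "x0 - x0\<^sup>2 = label_var" by (simp add: algebra_simps power2_eq_square)
  then have "(\<integral>N. step h Y N * step h Y N \<partial>offspring chi) = x0"
    using corr_step[OF rY meanY rY meanY] cov_map_label_var sqY by (simp add: algebra_simps power2_eq_square)
  then have stepY: "AE N in offspring chi. Y N = step h Y N"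
    by (intro sq_diff_0_AE rY rS) (simp add: integral_sq_diff(1)[OF rY rS] sqY crossY)
  have "(\<integral>N. Y N - Y N * Y N \<partial>offspring chi) = 0"
    using unit_valued_integrable[OF rY] unit_valued_integrable[OF unit_valued_mult[OF rY rY]]
      by (simp add: meanY sqY)
  moreover have "0 \<le> Y N - Y N * Y N" for N
    using rY mult_left_le[of "Y N" "Y N"] by (simp add: unit_valued_def)
  ultimately have "AE N in offspring chi. Y N - Y N * Y N = 0"
    using unit_valued_integrable[OF rY] unit_valued_integrable[OF unit_valued_mult[OF rY rY]]
    by (subst (asm) integral_nonneg_eq_0_iff_AE) auto
  with lim have XY: "AE N in offspring chi. X N = Y N"
    by eventually_elim (auto simp: X_def)
  have "solution X"
    unfolding solution_def
  proof (intro conjI allI)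
    show [measurable]: "X \<in> borel_measurable (offspring chi)" unfolding X_def by measurable
    show "X N = 0 \<or> X N = 1" for N by (simp add: X_def)
    show "(\<integral>N. X N \<partial>offspring chi) = x0"
      unfolding meanY[symmetric] by (intro integral_cong_AE XY) measurable
    show "AE N in offspring chi. X N = step h X N"
      using XY AE_below[OF XY] stepY by eventually_elim (use step_cong[of X _ Y h] in auto)
  qed
  then show thesis by (intro that[of r]) (simp add: X_def[abs_def] Z_def[abs_def])
qed

end

section \<open>Trees and interpretations\<close>

text \<open>
  Recovers the offspring numbers from a rooted tree, with value 0 at words which are not vertices of it.
\<close>

definition outdegree :: "nat list set \<Rightarrow> nat list \<Rightarrow> nat" where
  "outdegree t v = card {i. v @ [i] \<in> t}"

lemma tree_of_snoc: "v @ [i] \<in> tree_of N \<longleftrightarrow> v \<in> tree_of N \<and> i < N v"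
  by (auto simp: tree_of_def nth_append less_Suc_eq)

lemma tree_of_Nil: "[] \<in> tree_of N"
  by (simp add: tree_of_def)

lemma tree_of_Cons: "i # v \<in> tree_of N \<longleftrightarrow> i < N [] \<and> v \<in> tree_of (below i N)"
proof (induction v rule: rev_induct)
  case Nil
  show ?case using tree_of_snoc[of "[]" i N] by (simp add: tree_of_Nil)
next
  case (snoc j v)
  then show ?case using tree_of_snoc[of "i # v" j N] by (auto simp: tree_of_snoc below_def)
qed

lemma outdegree_tree_of: "v \<in> tree_of N \<Longrightarrow> outdegree (tree_of N) v = N v"
  by (simp add: outdegree_def tree_of_snoc)

lemma tree_of_outdegree:
  assumes t: "t \<in> rooted_trees" shows "tree_of (outdegree t) = t"
proof -
  have "v \<in> tree_of (outdegree t) \<longleftrightarrow> v \<in> t" for v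
  proof (induction v rule: rev_induct)
    case Nil
    show ?case using t by (simp add: tree_of_Nil rooted_trees_def)
  next
    case (snoc i v)
    have "v @ [i] \<in> t \<longleftrightarrow> v \<in> t \<and> i < outdegree t v"
    proof (cases "v \<in> t")
      case True
      with t obtain n where n: "{i. v @ [i] \<in> t} = {..<n}" by (auto simp: rooted_trees_def)
      then have "v @ [i] \<in> t \<longleftrightarrow> i < n" by blast
      then show ?thesis using n True by (simp add: outdegree_def)
    next
      case False
      then show ?thesis using t by (auto simp: rooted_trees_def)
    qed
    then show ?case using snoc by (simp add: tree_of_snoc)
  qed
  then show ?thesis by blast
qed

lemma num_children_tree_of: "num_children (tree_of N) = N []"
  using outdegree_tree_of[OF tree_of_Nil, of N] by (simp add: outdegree_def num_children_def)

lemma child_subtree_tree_of: "i < N [] \<Longrightarrow> child_subtree (tree_of N) i = tree_of (below i N)"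
  by (simp add: child_subtree_def tree_of_Cons)

lemma child_count_tree_of:
  "child_count (tree_of N) T = card {i. i < N [] \<and> tree_of (below i N) \<in> T}"
  unfolding child_count_def
  by (rule arg_cong[where f=card]) (auto simp: tree_of_Cons tree_of_Nil child_subtree_tree_of)

lemma space_tree_space: "space tree_space = rooted_trees"
  by (simp add: tree_space_def space_measure_of_conv)

lemma sets_tree_space_mem: "{t \<in> rooted_trees. v \<in> t} \<in> sets tree_space"
  by (auto simp: tree_space_def intro!: sigma_sets.Basic)

lemma measurable_outdegree: "outdegree \<in> tree_space \<rightarrow>\<^sub>M offspring chi"
proof (rule measurable_into_offspring)
  fix v
  have "Measurable.pred tree_space (\<lambda>t. w \<notin> t)" for w
  proof -
    have "{t \<in> space tree_space. w \<notin> t} = space tree_space - {t \<in> rooted_trees. w \<in> t}"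
      by (auto simp: space_tree_space)
    also have "\<dots> \<in> sets tree_space" using sets_tree_space_mem by blast
    finally show ?thesis by (simp add: pred_def)
  qed
  then have least: "(\<lambda>t. LEAST i. v @ [i] \<notin> t) \<in> tree_space \<rightarrow>\<^sub>M count_space UNIV"
    by (rule measurable_Least)
  have eq: "outdegree t v = (LEAST i. v @ [i] \<notin> t)" if t: "t \<in> rooted_trees" for t
  proof -
    obtain n where n: "{i. v @ [i] \<in> t} = {..<n}"
    proof (cases "v \<in> t")
      case True
      with t that show thesis unfolding rooted_trees_def by blast
    next
      case False
      then have "{i. v @ [i] \<in> t} = {..<0}" using t unfolding rooted_trees_def by auto
      then show thesis by (rule that)
    qed
    then have "v @ [i] \<in> t \<longleftrightarrow> i < n" for i by blast
    then have "(LEAST i. v @ [i] \<notin> t) = n"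
      by (intro Least_equality) (simp_all add: not_less)
    then show ?thesis using n by (simp add: outdegree_def)
  qed
  have "(\<lambda>t. outdegree t v) \<in> tree_space \<rightarrow>\<^sub>M count_space UNIV \<longleftrightarrow>
      (\<lambda>t. LEAST i. v @ [i] \<notin> t) \<in> tree_space \<rightarrow>\<^sub>M count_space UNIV"
    by (rule measurable_cong) (simp only: eq space_tree_space)
  with least show "(\<lambda>t. outdegree t v) \<in> tree_space \<rightarrow>\<^sub>M count_space UNIV"
    by (simp only:)
qed

lemma sets_GW: "sets (GW chi) = sets tree_space"
  by (simp add: GW_def)

lemma AE_GW_D: "AE t in GW chi. P t \<Longrightarrow> AE N in offspring chi. P (tree_of N)"
  unfolding GW_def by (rule AE_distrD[OF measurable_tree_of])

lemma AE_GW_I: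
  assumes "AE N in offspring chi. P (tree_of N)" "{t \<in> rooted_trees. P t} \<in> sets tree_space"
  shows "AE t in GW chi. P t"
  unfolding GW_def using assms by (subst AE_distr_iff[OF measurable_tree_of]) (simp_all add: space_tree_space)

lemma measure_GW:
  assumes "A \<in> sets tree_space"
  shows "measure (GW chi) A = (\<integral>N. of_bool (tree_of N \<in> A) \<partial>offspring chi)"
proof -
  have "measure (GW chi) A = measure (offspring chi) (tree_of -` A \<inter> space (offspring chi))"
    unfolding GW_def by (rule measure_distr[OF measurable_tree_of assms])
  also have "\<dots> = (\<integral>N. indicator (tree_of -` A \<inter> space (offspring chi)) N \<partial>offspring chi)"
    using measurable_sets[OF measurable_tree_of assms] by simp
  finally show ?thesis by (simp add: indicator_def of_bool_def vimage_def)
qed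

lemma step_bool:
  assumes "\<And>i. X (below i N) = of_bool (B i)"
  shows "step h X N = of_bool (h (N []) \<le> card {i. i < N [] \<and> B i})"
proof -
  let ?A = "{i. i < N [] \<and> B i}"
  have "step h X N = multilinear (N []) (threshold (h (N []))) (\<lambda>i. of_bool (i \<in> ?A))"
    unfolding step_def by (intro multilinear_cong) (auto simp: assms)
  also have "\<dots> = threshold (h (N [])) ?A" by (rule multilinear_bool) auto
  finally show ?thesis by (simp add: threshold_def)
qed

context fixed_point
begin

text \<open>
  The offspring numbers of words outside the tree do not enter the recursion.
\<close>

lemma posterior_cong: "(\<And>v. v \<in> tree_of N \<Longrightarrow> N v = N' v) \<Longrightarrow> posterior n N = posterior n N'"
proof (induction n arbitrary: N N')
  case (Suc n)
  have "N [] = N' []" using Suc.prems[OF tree_of_Nil] .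
  moreover have "posterior n (below i N) = posterior n (below i N')" if "i < N []" for i
  proof (rule Suc.IH)
    fix v assume "v \<in> tree_of (below i N)"
    then show "below i N v = below i N' v"
      using Suc.prems[of "i # v"] that by (simp only: tree_of_Cons) (simp add: below_def)
  qed
  ultimately show ?case unfolding posterior_Suc step_def by (auto intro!: multilinear_cong)
qed (simp add: posterior_0)

lemma posterior_outdegree: "posterior n (outdegree (tree_of N)) = posterior n N"
  by (rule posterior_cong[symmetric]) (simp add: outdegree_tree_of)

text \<open>
  A set in the completed \<open>\<sigma>\<close>-algebra is replaced by a measurable one. This keeps the recursion valid almost
  surely, because all root-child subtrees have the law of the tree itself (\<open>AE_below\<close>).
\<close>

lemma interpretation_solution:
  assumes I: "is_interpretation chi h T" "measure (completion (GW chi)) T = x0"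
  obtains T' where "T' \<in> sets tree_space" "AE t in GW chi. t \<in> T \<longleftrightarrow> t \<in> T'"
    "solution (\<lambda>N. of_bool (tree_of N \<in> T'))"
proof -
  have "T \<in> sets (completion (GW chi))" using I by (simp add: is_interpretation_def)
  then obtain S N N' where T: "T = S \<union> N" "N \<subseteq> N'" "N' \<in> null_sets (GW chi)" "S \<in> sets (GW chi)"
    by (rule sets_completionE)
  have ae: "AE t in GW chi. t \<in> T \<longleftrightarrow> t \<in> S"
    using AE_not_in[OF T(3)] by eventually_elim (use T in auto)
  have S: "S \<in> sets tree_space" using T by (simp add: sets_GW)
  have aeO: "AE N in offspring chi. tree_of N \<in> T \<longleftrightarrow> tree_of N \<in> S" by (rule AE_GW_D[OF ae])
  let ?X = "\<lambda>N. of_bool (tree_of N \<in> S) :: real"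
  have "measure (GW chi) S = x0"
  proof -
    have "emeasure (completion (GW chi)) T = emeasure (completion (GW chi)) S"
      using ae T \<open>T \<in> sets (completion (GW chi))\<close>
      by (intro emeasure_eq_AE) (auto intro: AE_completion)
    then show ?thesis using I(2) T by (simp add: measure_def)
  qed
  then have mean: "(\<integral>N. ?X N \<partial>offspring chi) = x0" using measure_GW[OF S] by simp
  have meas: "?X \<in> borel_measurable (offspring chi)"
  proof -
    have "Measurable.pred (offspring chi) (\<lambda>N. tree_of N \<in> S)"
      using measurable_sets[OF measurable_tree_of S, of chi] by (simp add: pred_def vimage_def)
    then show ?thesis by measurable
  qed
  have "AE N in offspring chi. tree_of N \<in> T \<longleftrightarrow> h (num_children (tree_of N)) \<le> child_count (tree_of N) T"
    using I(1) by (intro AE_GW_D) (simp add: is_interpretation_def)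
  with aeO AE_below[OF aeO] have "AE N in offspring chi. ?X N = step h ?X N"
    by eventually_elim (simp add: step_bool[where B="\<lambda>i. tree_of (below i _) \<in> S"]
        num_children_tree_of child_count_tree_of)
  then have "solution ?X" using mean meas by (simp add: solution_def)
  with S ae show thesis by (rule that)
qed

lemma interpretation_unique:
  assumes "is_interpretation chi h T" "measure (completion (GW chi)) T = x0"
    and "is_interpretation chi h U" "measure (completion (GW chi)) U = x0"
  shows "(T - U) \<union> (U - T) \<in> null_sets (completion (GW chi))"
proof -
  obtain T' where T': "T' \<in> sets tree_space" "AE t in GW chi. t \<in> T \<longleftrightarrow> t \<in> T'"
    "solution (\<lambda>N. of_bool (tree_of N \<in> T'))" using interpretation_solution[OF assms(1,2)] .
  obtain U' where U': "U' \<in> sets tree_space" "AE t in GW chi. t \<in> U \<longleftrightarrow> t \<in> U'"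
    "solution (\<lambda>N. of_bool (tree_of N \<in> U'))" using interpretation_solution[OF assms(3,4)] .
  have "AE N in offspring chi. tree_of N \<in> T' \<longleftrightarrow> tree_of N \<in> U'"
    using solution_unique[OF T'(3) U'(3)] by eventually_elim (simp add: of_bool_eq_iff)
  moreover have "{t \<in> rooted_trees. t \<in> T' \<longleftrightarrow> t \<in> U'} \<in> sets tree_space"
  proof -
    have "{t \<in> rooted_trees. t \<in> T' \<longleftrightarrow> t \<in> U'} = space tree_space - ((T' - U') \<union> (U' - T'))"
      by (auto simp: space_tree_space)
    then show ?thesis using T'(1) U'(1) by simp
  qed
  ultimately have "AE t in GW chi. t \<in> T' \<longleftrightarrow> t \<in> U'" by (rule AE_GW_I)
  with T'(2) U'(2) have "AE t in GW chi. t \<notin> (T - U) \<union> (U - T)"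
    by eventually_elim auto
  then have ae: "AE t in completion (GW chi). t \<notin> (T - U) \<union> (U - T)"
    by (rule AE_completion)
  have "(T - U) \<union> (U - T) \<in> sets (completion (GW chi))"
    using assms by (intro sets.Un sets.Diff) (auto simp: is_interpretation_def)
  then show ?thesis using ae AE_iff_null_sets by blast
qed

text \<open>
  The defining property of an interpretation concerns a set of trees whose measurability is not evident. For
  trees \<open>t\<close> it is equivalent to \<open>X = step h X\<close> at \<open>outdegree t\<close>, which is a measurable condition.
\<close>

lemma solution_interpretation:
  assumes X: "solution X" and deg: "\<And>N. X (outdegree (tree_of N)) = X N"
  shows "\<exists>T. is_interpretation chi h T \<and> measure (completion (GW chi)) T = x0"
proof -
  define T where "T = {t \<in> rooted_trees. X (outdegree t) = 1}"
  have Xm[measurable]: "X \<in> borel_measurable (offspring chi)" using X by (simp add: solution_def)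
  note [measurable] = measurable_outdegree[of chi]
  have "{t \<in> space tree_space. X (outdegree t) = 1} \<in> sets tree_space" by measurable
  then have T: "T \<in> sets tree_space" by (simp add: T_def space_tree_space)
  have X01: "X N = of_bool (X N = 1)" for N using X by (auto simp: solution_def)
  have mem: "tree_of N \<in> T \<longleftrightarrow> X N = 1" for N
    by (simp add: T_def tree_of_in_rooted_trees deg)
  have st: "step h X N = of_bool (h (N []) \<le> card {i. i < N [] \<and> X (below i N) = 1})" for N
    by (rule step_bool) (rule X01)
  have iff: "(tree_of N \<in> T \<longleftrightarrow> h (num_children (tree_of N)) \<le> child_count (tree_of N) T) \<longleftrightarrow> X N = step h X N"
      for N
    unfolding mem num_children_tree_of child_count_tree_of st by (subst (2) X01) (simp add: of_bool_eq_iff)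
  have "AE t in GW chi. t \<in> T \<longleftrightarrow> child_count t T \<ge> h (num_children t)"
  proof (rule AE_GW_I)
    show "AE N in offspring chi. tree_of N \<in> T \<longleftrightarrow> child_count (tree_of N) T \<ge> h (num_children (tree_of N))"
      unfolding iff using X by (simp add: solution_def)
    have [measurable]: "step h X \<in> borel_measurable (offspring chi)"
      using unit_valued_step[OF unit_valued_solution[OF X], of h] by (simp add: unit_valued_def)
    have "{t \<in> space tree_space. X (outdegree t) = step h X (outdegree t)} \<in> sets tree_space" by measurable
    moreover have "(t \<in> T \<longleftrightarrow> h (num_children t) \<le> child_count t T) \<longleftrightarrow> X (outdegree t) = step h X (outdegree t)"
      if "t \<in> rooted_trees" for t using iff[of "outdegree t"] that by (simp add: tree_of_outdegree)
    ultimately show "{t \<in> rooted_trees. t \<in> T \<longleftrightarrow> child_count t T \<ge> h (num_children t)} \<in> sets tree_space"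
      by (simp add: space_tree_space cong: conj_cong)
  qed
  moreover have "measure (completion (GW chi)) T = x0"
  proof -
    have "measure (completion (GW chi)) T = measure (GW chi) T"
      using T by (simp add: measure_def sets_GW)
    also have "\<dots> = (\<integral>N. X N \<partial>offspring chi)"
      unfolding measure_GW[OF T] mem X01[symmetric] ..
    finally show ?thesis using X by (simp add: solution_def)
  qed
  ultimately show ?thesis
    using T by (auto simp: is_interpretation_def sets_GW intro!: exI[of _ T])
qed

lemma interpretation_iff:
  "(\<exists>T. is_interpretation chi h T \<and> measure (completion (GW chi)) T = x0) \<longleftrightarrow> expected_influence \<le> 1"
proof
  assume "\<exists>T. is_interpretation chi h T \<and> measure (completion (GW chi)) T = x0"
  then show "expected_influence \<le> 1"
    using interpretation_solution solution_imp_tendsto expected_influence_le_1 by metis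
next
  assume "expected_influence \<le> 1"
  then obtain r where "solution (\<lambda>N. of_bool (lim (\<lambda>i. posterior (r i) N) = 1))"
    using solution_exists[OF cov_tendsto] by blast
  then show "\<exists>T. is_interpretation chi h T \<and> measure (completion (GW chi)) T = x0"
    by (rule solution_interpretation) (simp add: posterior_outdegree)
qed

end

theorem proposition1p1:
  fixes chi :: "nat pmf" and h :: "nat \<Rightarrow> nat" and x0 :: real
  assumes "\<And>l. h l \<ge> 1"
    and "integrable (measure_pmf chi) (\<lambda>n. real n)"
    and "\<exists>a\<in>set_pmf chi. \<exists>b\<in>set_pmf chi. a \<noteq> b"
    and "0 < x0" and "x0 < 1"
    and "automaton_map chi h x0 = x0"
  shows "((\<exists>\<T>. is_interpretation chi h \<T> \<and> measure (completion (GW chi)) \<T> = x0)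
            \<longleftrightarrow> deriv (automaton_map chi h) x0 \<le> 1) \<and>
         (\<forall>\<T> \<T>'. is_interpretation chi h \<T> \<and> measure (completion (GW chi)) \<T> = x0 \<and>
                  is_interpretation chi h \<T>' \<and> measure (completion (GW chi)) \<T>' = x0
            \<longrightarrow> (\<T> - \<T>') \<union> (\<T>' - \<T>) \<in> null_sets (completion (GW chi)))"
proof -
  interpret fixed_point chi h x0
    using assms by unfold_locales
  show ?thesis
    using interpretation_iff interpretation_unique by (auto simp: deriv_automaton_map)
qed

end
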